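(* Let $\mathfrak{G}$ be an ample groupoid and $\Bbbk$ a field. (i) If $\mathfrak{G}$ is Hausdorff and essentially principal, then for every ideal $I$ of the Steinberg algebra $\Bbbk\mathfrak{G}$ there exist open $\mathfrak{G}$-invariant sets $U_1\subset U_2\subset\mathfrak{G}^{(0)}$ such that $U_1$ is dense in $U_2$ and $\Bbbk\mathfrak{G}|_{U_1}\subset I\subset\Bbbk\mathfrak{G}|_{U_2}$. (ii) If $\mathfrak{G}$ is principal, then the map $U\mapsto\Bbbk\mathfrak{G}|_U$ is a bijection between the set of open $\mathfrak{G}$-invariant subsets of $\mathfrak{G}^{(0)}$ and the set of (two-sided) ideals of $\Bbbk\mathfrak{G}$.
   Context: For an element $g$ of a groupoid, $\mathsf{s}(g)=g^{-1}g$ and $\mathsf{r}(g)=gg^{-1}$. Topological groupoids are locally compact with Hausdorff unit space $\mathfrak{G}^{(0)}$ (the groupoid itself need not be Hausdorff unless stated). A bisection is a subset on which $\mathsf{s}$ and $\mathsf{r}$ are homeomorphisms onto their images. A groupoid is ample if it has a basis of topology consisting of compact open bisections; ample groupoids are assumed second countable. The isotropy group of $x\in\mathfrak{G}^{(0)}$ is $\{g:\mathsf{s}(g)=\mathsf{r}(g)=x\}$. $\mathfrak{G}$ is principal if all isotropy groups are trivial, and essentially principal if the set of units with trivial isotropy group is dense in $\mathfrak{G}^{(0)}$. A set $U\subset\mathfrak{G}^{(0)}$ is $\mathfrak{G}$-invariant if $\mathsf{s}(g)\in U$ implies $\mathsf{r}(g)\in U$. $\mathfrak{G}|_U=\{g\in\mathfrak{G}:\mathsf{s}(g),\mathsf{r}(g)\in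 U\}$. The Steinberg algebra $\Bbbk\mathfrak{G}$ is the $\Bbbk$-linear span of the indicator functions $1_F\colon\mathfrak{G}\to\Bbbk$ of compact open bisections $F$, with convolution product $(f_1f_2)(g)=\sum_{g=g_1g_2}f_1(g_1)f_2(g_2)$. For an open set $U\subset\mathfrak{G}^{(0)}$, $\Bbbk\mathfrak{G}|_U$ denotes the Steinberg algebra of $\mathfrak{G}|_U$, viewed (extending functions by zero) as a subalgebra of $\Bbbk\mathfrak{G}$; it is an ideal if $U$ is $\mathfrak{G}$-invariant.
   Formalization: Ample groupoids are additionally required to be étale (source and range are local homeomorphisms onto the unit space); without this the span of indicators of compact open bisections need not be closed under convolution. *)

theory Defs
  imports "HOL-Analysis.Analysis" "HOL-Library.Function_Algebras"
begin

section \<open>Groupoids\<close>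

text \<open>
  The set of elements of the groupoid is the underlying set of the topology \<open>gtop\<close>;
  \<open>gmult\<close> is only meaningful on the pairs in \<open>composable\<close>.
\<close>

record 'a groupoid =
  gtop :: "'a topology"
  composable :: "('a \<times> 'a) set"
  gmult :: "'a \<Rightarrow> 'a \<Rightarrow> 'a"
  ginv :: "'a \<Rightarrow> 'a"

abbreviation gcarrier :: "('a, 'b) groupoid_scheme \<Rightarrow> 'a set" where
  "gcarrier G \<equiv> topspace (gtop G)"

definition src :: "('a, 'b) groupoid_scheme \<Rightarrow> 'a \<Rightarrow> 'a" where
  "src G g = gmult G (ginv G g) g"

definition rng :: "('a, 'b) groupoid_scheme \<Rightarrow> 'a \<Rightarrow> 'a" where
  "rng G g = gmult G g (ginv G g)"

definition units :: "('a, 'b) groupoid_scheme \<Rightarrow> 'a set" where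
  "units G = src G ` gcarrier G"

abbreviation unit_space :: "('a, 'b) groupoid_scheme \<Rightarrow> 'a topology" where
  "unit_space G \<equiv> subtopology (gtop G) (units G)"

text \<open>
  Renault's axioms. They imply that \<open>g\<close>, \<open>h\<close> are composable
  if and only if \<open>src G g = rng G h\<close>; see \<open>composable_iff\<close> below.
\<close>

definition is_groupoid :: "('a, 'b) groupoid_scheme \<Rightarrow> bool" where
  "is_groupoid G \<longleftrightarrow>
     composable G \<subseteq> gcarrier G \<times> gcarrier G \<and>
     (\<forall>g h. (g, h) \<in> composable G \<longrightarrow> gmult G g h \<in> gcarrier G) \<and>
     (\<forall>g\<in>gcarrier G. ginv G g \<in> gcarrier G \<and> ginv G (ginv G g) = g) \<and>
     (\<forall>g h k. (g, h) \<in> composable G \<and> (h, k) \<in> composable G \<longrightarrow>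
        (gmult G g h, k) \<in> composable G \<and> (g, gmult G h k) \<in> composable G \<and>
        gmult G (gmult G g h) k = gmult G g (gmult G h k)) \<and>
     (\<forall>g\<in>gcarrier G. (ginv G g, g) \<in> composable G \<and> (g, ginv G g) \<in> composable G) \<and>
     (\<forall>g h. (g, h) \<in> composable G \<longrightarrow>
        gmult G (ginv G g) (gmult G g h) = h \<and> gmult G (gmult G g h) (ginv G h) = g)"

lemma composable_iff:
  assumes "is_groupoid G" "g \<in> gcarrier G" "h \<in> gcarrier G"
  shows "(g, h) \<in> composable G \<longleftrightarrow> src G g = rng G h"
proof
  assume gh: "(g, h) \<in> composable G"
  have inv: "(ginv G g, g) \<in> composable G" "(h, ginv G h) \<in> composable G"
    using assms unfolding is_groupoid_def by blast+
  have assoc: "\<And>a b c. (a, b) \<in> composable G \<Longrightarrow> (b, c) \<in> composable G \<Longrightarrow>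
      (gmult G a b, c) \<in> composable G \<and> gmult G (gmult G a b) c = gmult G a (gmult G b c)"
    and cancel: "\<And>a b. (a, b) \<in> composable G \<Longrightarrow>
      gmult G (ginv G a) (gmult G a b) = b \<and> gmult G (gmult G a b) (ginv G b) = a"
    using assms(1) unfolding is_groupoid_def by blast+
  have "gmult G (src G g) h = h"
    using assoc[OF inv(1) gh] cancel[OF gh] by (simp add: src_def)
  moreover have "(src G g, h) \<in> composable G"
    using assoc[OF inv(1) gh] by (simp add: src_def)
  ultimately show "src G g = rng G h"
    using cancel[of "src G g" h] by (simp add: rng_def)
next
  assume eq: "src G g = rng G h"
  have inv: "(ginv G g, g) \<in> composable G" "(g, ginv G g) \<in> composable G"
    "(h, ginv G h) \<in> composable G" "(ginv G h, h) \<in> composable G"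
    using assms unfolding is_groupoid_def by blast+
  have assoc: "\<And>a b c. (a, b) \<in> composable G \<Longrightarrow> (b, c) \<in> composable G \<Longrightarrow>
      (gmult G a b, c) \<in> composable G \<and> (a, gmult G b c) \<in> composable G \<and>
      gmult G (gmult G a b) c = gmult G a (gmult G b c)"
    and cancel: "\<And>a b. (a, b) \<in> composable G \<Longrightarrow> gmult G (gmult G a b) (ginv G b) = a"
    and inv_inv: "ginv G (ginv G g) = g"
    using assms unfolding is_groupoid_def by blast+
  have 1: "(g, src G g) \<in> composable G" "gmult G g (src G g) = g"
    using assoc[OF inv(2) inv(1)] cancel[OF inv(2)] by (simp_all add: src_def inv_inv)
  have 2: "(rng G h, h) \<in> composable G"
    using assoc[OF inv(3) inv(4)] by (simp add: rng_def)
  show "(g, h) \<in> composable G"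
    using assoc[OF 1(1) 2[folded eq]] 1(2) by simp
qed

definition isotropy_group :: "('a, 'b) groupoid_scheme \<Rightarrow> 'a \<Rightarrow> 'a set" where
  "isotropy_group G x = {g \<in> gcarrier G. src G g = x \<and> rng G g = x}"

definition principal_groupoid :: "('a, 'b) groupoid_scheme \<Rightarrow> bool" where
  "principal_groupoid G \<longleftrightarrow> (\<forall>x\<in>units G. isotropy_group G x = {x})"

definition essentially_principal :: "('a, 'b) groupoid_scheme \<Rightarrow> bool" where
  "essentially_principal G \<longleftrightarrow>
     unit_space G closure_of {x \<in> units G. isotropy_group G x = {x}} = units G"

definition invariant :: "('a, 'b) groupoid_scheme \<Rightarrow> 'a set \<Rightarrow> bool" where
  "invariant G U \<longleftrightarrow> (\<forall>g\<in>gcarrier G. src G g \<in> U \<longrightarrow> rng G g \<in> U)"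

definition restrict_groupoid ::
  "('a, 'b) groupoid_scheme \<Rightarrow> 'a set \<Rightarrow> ('a, 'b) groupoid_scheme" where
  "restrict_groupoid G U =
     (let H = {g \<in> gcarrier G. src G g \<in> U \<and> rng G g \<in> U}
      in G\<lparr>gtop := subtopology (gtop G) H, composable := composable G \<inter> H \<times> H\<rparr>)"


section \<open>Topological and ample groupoids\<close>

definition topological_groupoid :: "('a, 'b) groupoid_scheme \<Rightarrow> bool" where
  "topological_groupoid G \<longleftrightarrow>
     is_groupoid G \<and>
     continuous_map (subtopology (prod_topology (gtop G) (gtop G)) (composable G)) (gtop G)
       (\<lambda>(g, h). gmult G g h) \<and>
     continuous_map (gtop G) (gtop G) (ginv G) \<and>
     locally_compact_space (gtop G) \<and>
     Hausdorff_space (unit_space G)"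

definition bisection :: "('a, 'b) groupoid_scheme \<Rightarrow> 'a set \<Rightarrow> bool" where
  "bisection G F \<longleftrightarrow>
     F \<subseteq> gcarrier G \<and>
     homeomorphic_map (subtopology (gtop G) F) (subtopology (gtop G) (src G ` F)) (src G) \<and>
     homeomorphic_map (subtopology (gtop G) F) (subtopology (gtop G) (rng G ` F)) (rng G)"

definition local_homeomorphism :: "'a topology \<Rightarrow> 'b topology \<Rightarrow> ('a \<Rightarrow> 'b) \<Rightarrow> bool" where
  "local_homeomorphism X Y f \<longleftrightarrow>
     (\<forall>x\<in>topspace X. \<exists>V. openin X V \<and> x \<in> V \<and> openin Y (f ` V) \<and>
        homeomorphic_map (subtopology X V) (subtopology Y (f ` V)) f)"

definition etale :: "('a, 'b) groupoid_scheme \<Rightarrow> bool" where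
  "etale G \<longleftrightarrow>
     local_homeomorphism (gtop G) (unit_space G) (src G) \<and>
     local_homeomorphism (gtop G) (unit_space G) (rng G)"

text \<open>
  Ample groupoids are by convention etale. This does not follow from the existence of a basis of
  compact open bisections: adjoin to the unit groupoid on a convergent sequence a single
  isolated element of order two at the limit point. There the images of open bisections under
  \<open>src\<close> need not be open, and the span of the indicator functions of compact open bisections
  is not closed under convolution.
\<close>

definition ample :: "('a, 'b) groupoid_scheme \<Rightarrow> bool" where
  "ample G \<longleftrightarrow>
     topological_groupoid G \<and> etale G \<and> second_countable (gtop G) \<and>
     (\<forall>U g. openin (gtop G) U \<and> g \<in> U \<longrightarrow>
        (\<exists>F. openin (gtop G) F \<and> compactin (gtop G) F \<and> bisection G F \<and> g \<in> F \<and> F \<subseteq> U))"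


section \<open>Steinberg algebras\<close>

text \<open>
  Functions on the groupoid are total functions that vanish outside the carrier. In particular,
  the Steinberg algebra of \<open>restrict_groupoid G U\<close> consists of functions
  already extended by zero to \<open>G\<close>.
\<close>

definition fun_scale :: "'k::field \<Rightarrow> ('a \<Rightarrow> 'k) \<Rightarrow> 'a \<Rightarrow> 'k" where
  "fun_scale c f = (\<lambda>g. c * f g)"

lemma module_fun_scale: "module fun_scale"
  by unfold_locales (auto simp: fun_scale_def algebra_simps)

definition steinberg_algebra :: "('a, 'b) groupoid_scheme \<Rightarrow> ('a \<Rightarrow> 'k::field) set" where
  "steinberg_algebra G =
     module.span fun_scale
       {indicator F | F. openin (gtop G) F \<and> compactin (gtop G) F \<and> bisection G F}"

text \<open>
  The sum over all factorizations of \<open>g\<close> is restricted to its non-zero terms, of which there are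
  finitely many whenever \<open>f1\<close> and \<open>f2\<close> lie in the Steinberg algebra of an ample groupoid.
\<close>

definition convolution ::
  "('a, 'b) groupoid_scheme \<Rightarrow> ('a \<Rightarrow> 'k::field) \<Rightarrow> ('a \<Rightarrow> 'k) \<Rightarrow> 'a \<Rightarrow> 'k" where
  "convolution G f1 f2 = (\<lambda>g.
     \<Sum>(g1, g2) \<in> {(g1, g2) \<in> composable G. gmult G g1 g2 = g \<and> f1 g1 \<noteq> 0 \<and> f2 g2 \<noteq> 0}.
       f1 g1 * f2 g2)"

text \<open>
  Two-sided ideals in the sense of ring theory. The Steinberg algebra need not have a unit, but
  each of its elements is fixed by convolution with \<open>indicator V\<close> for some compact open
  \<open>V \<subseteq> units G\<close>, so such ideals are automatically linear subspaces.
\<close>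

definition steinberg_ideal :: "('a, 'b) groupoid_scheme \<Rightarrow> ('a \<Rightarrow> 'k::field) set \<Rightarrow> bool" where
  "steinberg_ideal G I \<longleftrightarrow>
     I \<subseteq> steinberg_algebra G \<and> 0 \<in> I \<and>
     (\<forall>f\<in>I. \<forall>h\<in>I. f + h \<in> I) \<and> (\<forall>f\<in>I. - f \<in> I) \<and>
     (\<forall>f\<in>steinberg_algebra G. \<forall>h\<in>I. convolution G f h \<in> I \<and> convolution G h f \<in> I)"

end

theory Submission
  imports Defs
begin

text \<open>
  Let \<open>U\<^sub>1\<close> be the set of all units lying in compact open bisections \<open>P\<close> with \<open>1\<^sub>P \<in> I\<close>, and let \<open>U\<^sub>2\<close>
  be the set of sources of the supports of elements of \<open>I\<close>. The inclusions
  \<open>k\<GG>|\<^sub>U\<^sub>1 \<subseteq> I \<subseteq> k\<GG>|\<^sub>U\<^sub>2\<close> are formal, the second one because elements of the Steinberg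
  algebra of a Hausdorff groupoid are the locally constant functions of compact support. The
  point is that a unit \<open>y \<in> U\<^sub>2\<close> with trivial isotropy lies in \<open>U\<^sub>1\<close>: multiplying by a bisection
  gives \<open>h \<in> I\<close> with \<open>h(y) \<noteq> 0\<close>, and for a small compact open neighbourhood \<open>V\<close> of \<open>y\<close> in the unit
  space \<open>1\<^sub>V h 1\<^sub>V = h(y) 1\<^sub>V\<close>. Essential principality makes such units dense in \<open>U\<^sub>2\<close>, while in a
  principal groupoid, which is automatically Hausdorff, \<open>U\<^sub>1 = U\<^sub>2\<close>.
\<close>

section \<open>Groupoid identities and convolution\<close>

locale groupoid =
  fixes G :: "('a, 'b) groupoid_scheme"
  assumes is_groupoid: "is_groupoid G"
begin

section \<open>Algebraic laws of a groupoid derived from Renault's axioms\<close>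

lemma inv_closed [simp]: "g \<in> gcarrier G \<Longrightarrow> ginv G g \<in> gcarrier G"
  and inv_inv [simp]: "g \<in> gcarrier G \<Longrightarrow> ginv G (ginv G g) = g"
  using is_groupoid unfolding is_groupoid_def by blast+

lemma composableD:
  assumes "(g, h) \<in> composable G"
  shows "g \<in> gcarrier G" "h \<in> gcarrier G" "src G g = rng G h"
proof -
  show *: "g \<in> gcarrier G" "h \<in> gcarrier G"
    using is_groupoid assms unfolding is_groupoid_def by blast+
  show "src G g = rng G h"
    using composable_iff[OF is_groupoid *] assms by simp
qed

lemma composableI:
  "g \<in> gcarrier G \<Longrightarrow> h \<in> gcarrier G \<Longrightarrow> src G g = rng G h \<Longrightarrow> (g, h) \<in> composable G"
  using composable_iff[OF is_groupoid] by simp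

text \<open>Presents the composable pairs as the equalizer of source and range; in this form they
  are seen to be closed in the product of a Hausdorff groupoid with itself.\<close>

lemma composable_eq:
  "composable G = {p \<in> gcarrier G \<times> gcarrier G. src G (fst p) = rng G (snd p)}"
proof (intro set_eqI iffI)
  fix p assume "p \<in> composable G"
  then have "(fst p, snd p) \<in> composable G" by simp
  from composableD[OF this] show "p \<in> {p \<in> gcarrier G \<times> gcarrier G. src G (fst p) = rng G (snd p)}"
    by (simp add: mem_Times_iff)
next
  fix p assume "p \<in> {p \<in> gcarrier G \<times> gcarrier G. src G (fst p) = rng G (snd p)}"
  then show "p \<in> composable G"
    using composableI[of "fst p" "snd p"] by (simp add: mem_Times_iff)
qed

lemma mult_closed [simp]:
  "g \<in> gcarrier G \<Longrightarrow> h \<in> gcarrier G \<Longrightarrow> src G g = rng G h \<Longrightarrow> gmult G g h \<in> gcarrier G"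
  using composableI[of g h] is_groupoid unfolding is_groupoid_def by blast

lemma src_inv [simp]: "g \<in> gcarrier G \<Longrightarrow> src G (ginv G g) = rng G g"
  and rng_inv [simp]: "g \<in> gcarrier G \<Longrightarrow> rng G (ginv G g) = src G g"
  by (simp_all add: src_def rng_def)

text \<open>The associativity axiom makes both \<open>(gh, h^-1)\<close> and
  \<open>(g^-1, gh)\<close> composable, and composability of a pair means that source and range
  match.\<close>

lemma
  assumes "g \<in> gcarrier G" "h \<in> gcarrier G" "src G g = rng G h"
  shows src_mult [simp]: "src G (gmult G g h) = src G h"
    and rng_mult [simp]: "rng G (gmult G g h) = rng G g"
    and inv_mult_cancel [simp]: "gmult G (ginv G g) (gmult G g h) = h"
    and mult_inv_cancel [simp]: "gmult G (gmult G g h) (ginv G h) = g"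
proof -
  have gh: "(g, h) \<in> composable G" using assms by (rule composableI)
  have "(h, ginv G h) \<in> composable G" "(ginv G g, g) \<in> composable G"
    using is_groupoid assms unfolding is_groupoid_def by blast+
  with gh have "(gmult G g h, ginv G h) \<in> composable G" "(ginv G g, gmult G g h) \<in> composable G"
    using is_groupoid unfolding is_groupoid_def by blast+
  from this[THEN composableD(3)] show "src G (gmult G g h) = src G h" "rng G (gmult G g h) = rng G g"
    using assms by simp_all
  show "gmult G (ginv G g) (gmult G g h) = h" "gmult G (gmult G g h) (ginv G h) = g"
    using gh is_groupoid unfolding is_groupoid_def by blast+
qed

lemma
  assumes "g \<in> gcarrier G"
  shows src_closed [simp]: "src G g \<in> gcarrier G"
    and rng_closed [simp]: "rng G g \<in> gcarrier G"
    and src_src [simp]: "src G (src G g) = src G g"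
    and rng_src [simp]: "rng G (src G g) = src G g"
    and src_rng [simp]: "src G (rng G g) = rng G g"
    and rng_rng [simp]: "rng G (rng G g) = rng G g"
    and src_in_units [simp]: "src G g \<in> units G"
    and rng_in_units [simp]: "rng G g \<in> units G"
    and mult_src [simp]: "gmult G g (src G g) = g"
    and rng_mult_self [simp]: "gmult G (rng G g) g = g"
proof -
  note d = src_def[of G g] rng_def[of G g]
  show "src G g \<in> gcarrier G" "rng G g \<in> gcarrier G"
    unfolding d using assms by simp_all
  have "src G (gmult G (ginv G g) g) = src G g" "rng G (gmult G (ginv G g) g) = src G g"
    "src G (gmult G g (ginv G g)) = rng G g" "rng G (gmult G g (ginv G g)) = rng G g"
    using assms by simp_all
  then show "src G (src G g) = src G g" "rng G (src G g) = src G g"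
    "src G (rng G g) = rng G g" "rng G (rng G g) = rng G g"
    by (simp_all flip: d)
  show "src G g \<in> units G" "rng G g \<in> units G"
    unfolding units_def using assms inv_closed[of g] src_inv[of g] by (blast, metis imageI)
  show "gmult G g (src G g) = g" "gmult G (rng G g) g = g"
    unfolding d using inv_mult_cancel[of "ginv G g" g] mult_inv_cancel[of g "ginv G g"] assms
    by simp_all
qed

lemma
  assumes "x \<in> units G"
  shows unit_closed [simp]: "x \<in> gcarrier G"
    and src_unit [simp]: "src G x = x"
    and rng_unit [simp]: "rng G x = x"
  using assms unfolding units_def by auto

lemma inv_unit [simp]:
  assumes "x \<in> units G"
  shows "ginv G x = x"
proof -
  have "gmult G (ginv G x) x = x"
    using src_unit[OF assms] unfolding src_def .
  moreover have "gmult G (ginv G x) x = ginv G x"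
    using mult_src[of "ginv G x"] assms by simp
  ultimately show ?thesis by simp
qed

lemma units_subset: "units G \<subseteq> gcarrier G"
  by auto

lemma mult_inv_mult_cancel [simp]:
  assumes "g \<in> gcarrier G" "h \<in> gcarrier G" "rng G g = rng G h"
  shows "gmult G g (gmult G (ginv G g) h) = h"
  using inv_mult_cancel[of "ginv G g" h] assms by simp

lemma mult_inv_mult_cancel_right [simp]:
  assumes "g \<in> gcarrier G" "h \<in> gcarrier G" "src G g = src G h"
  shows "gmult G (gmult G g (ginv G h)) h = g"
  using mult_inv_cancel[of g "ginv G h"] assms by simp

text \<open>The product \<open>g h^-1\<close> belongs to the isotropy group at \<open>r(g)\<close>,
  hence is the unit \<open>r(g) = r(h)\<close>; multiplying by \<open>h\<close> on the right gives
  \<open>g = h\<close>.\<close>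

lemma trivial_isotropy_eq:
  assumes "isotropy_group G (rng G g) = {rng G g}"
    and "g \<in> gcarrier G" "h \<in> gcarrier G" "src G g = src G h" "rng G g = rng G h"
  shows "g = h"
proof -
  have "gmult G g (ginv G h) \<in> isotropy_group G (rng G g)"
    unfolding isotropy_group_def using assms(2-) by simp
  then have "gmult G g (ginv G h) = rng G g"
    using assms(1) by blast
  then have "gmult G g (ginv G h) = rng G h"
    using assms(5) by simp
  then show ?thesis
    using mult_inv_mult_cancel_right[of g h] assms(2-) by simp
qed

section \<open>Convolution as a finite sum over a range or source fibre\<close>

lemma convolution_eq_0: "g \<notin> gcarrier G \<Longrightarrow> convolution G f1 f2 g = 0"
  unfolding convolution_def
  by (rule sum.neutral) (auto simp: composable_eq)

text \<open>A factorization of \<open>g\<close> is determined by its left factor \<open>a\<close>,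
  the right one being \<open>a^-1 g\<close>. The index set \<open>A\<close> may exceed the support
  of \<open>f1\<close>, so that it can be chosen to suit the situation.\<close>

lemma convolution_left_sum:
  assumes "g \<in> gcarrier G" "finite A" "A \<subseteq> {a \<in> gcarrier G. rng G a = rng G g}"
    and "{a \<in> gcarrier G. rng G a = rng G g \<and> f1 a \<noteq> 0} \<subseteq> A"
  shows "convolution G f1 f2 g = (\<Sum>a\<in>A. f1 a * f2 (gmult G (ginv G a) g))"
proof -
  have "convolution G f1 f2 g =
      (\<Sum>a \<in> {a \<in> A. f1 a \<noteq> 0 \<and> f2 (gmult G (ginv G a) g) \<noteq> 0}. f1 a * f2 (gmult G (ginv G a) g))"
    unfolding convolution_def
    by (rule sum.reindex_bij_witness[where i = "\<lambda>a. (a, gmult G (ginv G a) g)" and j = fst])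
       (use assms in \<open>auto simp: composable_eq\<close>)
  also have "\<dots> = (\<Sum>a\<in>A. f1 a * f2 (gmult G (ginv G a) g))"
    by (rule sum.mono_neutral_left) (use assms in auto)
  finally show ?thesis .
qed

lemma convolution_right_sum:
  assumes "g \<in> gcarrier G" "finite A" "A \<subseteq> {a \<in> gcarrier G. src G a = src G g}"
    and "{a \<in> gcarrier G. src G a = src G g \<and> f2 a \<noteq> 0} \<subseteq> A"
  shows "convolution G f1 f2 g = (\<Sum>a\<in>A. f1 (gmult G g (ginv G a)) * f2 a)"
proof -
  have "convolution G f1 f2 g =
      (\<Sum>a \<in> {a \<in> A. f1 (gmult G g (ginv G a)) \<noteq> 0 \<and> f2 a \<noteq> 0}. f1 (gmult G g (ginv G a)) * f2 a)"
    unfolding convolution_def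
    by (rule sum.reindex_bij_witness[where i = "\<lambda>a. (gmult G g (ginv G a), a)" and j = snd])
       (use assms in \<open>auto simp: composable_eq\<close>)
  also have "\<dots> = (\<Sum>a\<in>A. f1 (gmult G g (ginv G a)) * f2 a)"
    by (rule sum.mono_neutral_left) (use assms in auto)
  finally show ?thesis .
qed

text \<open>Injectivity of the range map on \<open>F\<close> leaves \<open>a\<close> as the only
  possible left factor of \<open>g\<close>. Convolution with a bisection is thus a
  translation.\<close>

lemma convolution_indicator_left:
  fixes f :: "'a \<Rightarrow> 'k::field"
  assumes "F \<subseteq> gcarrier G" "inj_on (rng G) F" "a \<in> F" "g \<in> gcarrier G" "rng G a = rng G g"
  shows "convolution G (indicator F) f g = f (gmult G (ginv G a) g)"
proof -
  have "{b \<in> gcarrier G. rng G b = rng G g \<and> indicator F b \<noteq> (0::'k)} \<subseteq> {a}"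
    using assms by (auto simp: indicator_def intro: inj_onD[OF assms(2)])
  then show ?thesis
    using convolution_left_sum[of g "{a}" "indicator F" f] assms by (simp add: subset_iff)
qed

lemma convolution_indicator_left_eq_0:
  fixes f :: "'a \<Rightarrow> 'k::field"
  assumes "g \<in> gcarrier G" "rng G g \<notin> rng G ` F"
  shows "convolution G (indicator F) f g = 0"
proof -
  have "{b \<in> gcarrier G. rng G b = rng G g \<and> indicator F b \<noteq> (0::'k)} \<subseteq> {}"
    using assms(2) by (auto simp: indicator_def image_iff)
  then show ?thesis
    using convolution_left_sum[of g "{}" "indicator F" f] assms by simp
qed

text \<open>The only unit that can be a left factor of \<open>g\<close> is \<open>r(g)\<close>, so a
  set of units acts as a cut-off on the range.\<close>

lemma convolution_unit_left:
  fixes f :: "'a \<Rightarrow> 'k::field"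
  assumes "V \<subseteq> units G" "g \<in> gcarrier G"
  shows "convolution G (indicator V) f g = indicator V (rng G g) * f g"
proof (cases "rng G g \<in> V")
  case True
  have "inj_on (rng G) V" using assms(1) rng_unit by (metis inj_onI subsetD)
  moreover have "V \<subseteq> gcarrier G" using assms by auto
  ultimately show ?thesis
    using convolution_indicator_left[of V "rng G g" g f] True assms by simp
next
  case False
  have "rng G g \<notin> rng G ` V" using False assms(1) rng_unit by (metis imageE subsetD)
  then show ?thesis using convolution_indicator_left_eq_0 assms False by simp
qed

lemma convolution_unit_right:
  fixes f :: "'a \<Rightarrow> 'k::field"
  assumes "V \<subseteq> units G" "g \<in> gcarrier G"
  shows "convolution G f (indicator V) g = f g * indicator V (src G g)"
proof -
  have "{a \<in> gcarrier G. src G a = src G g \<and> indicator V a \<noteq> (0::'k)} \<subseteq> {src G g}"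
  proof
    fix a assume "a \<in> {a \<in> gcarrier G. src G a = src G g \<and> indicator V a \<noteq> (0::'k)}"
    then have "a \<in> V" "src G a = src G g" by (simp_all add: indicator_def split: if_splits)
    then show "a \<in> {src G g}" using subsetD[OF assms(1)] src_unit[of a] by simp
  qed
  then show ?thesis
    using convolution_right_sum[of g "{src G g}" "indicator V" f] assms
    by (cases "src G g \<in> V") simp_all
qed

lemma bisectionD:
  assumes "bisection G F"
  shows "F \<subseteq> gcarrier G" "inj_on (src G) F" "inj_on (rng G) F"
proof -
  show F: "F \<subseteq> gcarrier G"
    using assms unfolding bisection_def by blast
  then have "topspace (subtopology (gtop G) F) = F"
    by (rule topspace_subtopology_subset)
  then show "inj_on (src G) F" "inj_on (rng G) F"
    using assms homeomorphic_imp_injective_map unfolding bisection_def by metis+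
qed

end

interpretation fun_scale: module fun_scale
  by (rule module_fun_scale)

section \<open>Ample groupoids and compact open bisections\<close>

lemma local_homeomorphism_imp_open_map:
  assumes "local_homeomorphism X Y f"
  shows "open_map X Y f"
  unfolding open_map_def
proof (intro allI impI)
  fix U assume U: "openin X U"
  show "openin Y (f ` U)"
  proof (subst openin_subopen, intro ballI)
    fix y assume "y \<in> f ` U"
    then obtain x where x: "x \<in> U" "y = f x" by blast
    then have "x \<in> topspace X" using openin_subset[OF U] by blast
    then obtain V where V: "openin X V" "x \<in> V" "openin Y (f ` V)"
      "homeomorphic_map (subtopology X V) (subtopology Y (f ` V)) f"
      using assms unfolding local_homeomorphism_def by metis
    have "openin (subtopology X V) (U \<inter> V)"
      using U by (metis openin_subtopology_Int)
    then have "openin (subtopology Y (f ` V)) (f ` (U \<inter> V))"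
      using homeomorphic_imp_open_map[OF V(4)] unfolding open_map_def by blast
    then have "openin Y (f ` (U \<inter> V))"
      using V(3) openin_open_subtopology by blast
    then show "\<exists>T. openin Y T \<and> y \<in> T \<and> T \<subseteq> f ` U"
      using x V(2) by (intro exI[of _ "f ` (U \<inter> V)"]) blast
  qed
qed

lemma finite_fibre:
  assumes "inj_on f F"
  shows "finite {a \<in> F. f a = x}"
proof -
  have "f ` {a \<in> F. f a = x} \<subseteq> {x}" by blast
  moreover have "inj_on f {a \<in> F. f a = x}" using assms by (rule inj_on_subset) blast
  ultimately show ?thesis using finite_imageD finite_subset by blast
qed

locale ample_groupoid =
  fixes G :: "('a, 'b) groupoid_scheme"
  assumes ample: "ample G"
begin

sublocale groupoid G
  using ample unfolding ample_def topological_groupoid_def by unfold_locales blast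

lemma continuous_inv: "continuous_map (gtop G) (gtop G) (ginv G)"
  using ample unfolding ample_def topological_groupoid_def by blast

lemma continuous_mult:
  "continuous_map (subtopology (prod_topology (gtop G) (gtop G)) (composable G)) (gtop G)
    (\<lambda>p. gmult G (fst p) (snd p))"
  using ample unfolding ample_def topological_groupoid_def by (simp add: case_prod_unfold)

lemma continuous_mult':
  assumes "continuous_map X (gtop G) f" "continuous_map X (gtop G) h"
    and "\<And>x. x \<in> topspace X \<Longrightarrow> src G (f x) = rng G (h x)"
  shows "continuous_map X (gtop G) (\<lambda>x. gmult G (f x) (h x))"
proof -
  have "f x \<in> gcarrier G" "h x \<in> gcarrier G" if "x \<in> topspace X" for x
    using continuous_map_funspace[OF assms(1)] continuous_map_funspace[OF assms(2)] that by auto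
  then have "continuous_map X (subtopology (prod_topology (gtop G) (gtop G)) (composable G))
      (\<lambda>x. (f x, h x))"
    using assms by (auto simp: continuous_map_in_subtopology continuous_map_paired
        intro!: composableI)
  from continuous_map_compose[OF this continuous_mult] show ?thesis
    by (simp add: o_def)
qed

lemma continuous_src: "continuous_map (gtop G) (gtop G) (src G)"
  unfolding src_def[abs_def]
  by (intro continuous_mult' continuous_inv continuous_map_id[unfolded id_def]) simp

lemma continuous_rng: "continuous_map (gtop G) (gtop G) (rng G)"
  unfolding rng_def[abs_def]
  by (intro continuous_mult' continuous_inv continuous_map_id[unfolded id_def]) simp

lemma basis_bisection:
  assumes "openin (gtop G) U" "g \<in> U"
  obtains F where "openin (gtop G) F" "compactin (gtop G) F" "bisection G F" "g \<in> F" "F \<subseteq> U"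
  using ample assms unfolding ample_def by metis

lemma open_preimage_src: "openin (gtop G) U \<Longrightarrow> openin (gtop G) {g \<in> gcarrier G. src G g \<in> U}"
  using continuous_src openin_continuous_map_preimage by fastforce

lemma open_preimage_rng: "openin (gtop G) U \<Longrightarrow> openin (gtop G) {g \<in> gcarrier G. rng G g \<in> U}"
  using continuous_rng openin_continuous_map_preimage by fastforce

text \<open>Let \<open>F\<close> be an open bisection through the unit \<open>x\<close>. An element
  \<open>g\<close> of \<open>F\<close> whose source also lies in \<open>F\<close> has the same
  source as \<open>s(g)\<close>, so injectivity forces \<open>g = s(g)\<close>. Such elements form
  an open neighbourhood of \<open>x\<close>.\<close>

lemma open_units: "openin (gtop G) (units G)"
proof (subst openin_subopen, intro ballI)
  fix x assume x: "x \<in> units G"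
  then have "x \<in> gcarrier G" by simp
  then obtain F where F: "openin (gtop G) F" "bisection G F" "x \<in> F"
    using basis_bisection[OF openin_topspace] by metis
  let ?T = "F \<inter> {g \<in> gcarrier G. src G g \<in> F}"
  have "g \<in> units G" if "g \<in> ?T" for g
  proof -
    have "src G g = g"
      using inj_onD[OF bisectionD(2)[OF F(2)], of "src G g" g] that by simp
    then show ?thesis using that src_in_units[of g] by (metis Int_iff mem_Collect_eq)
  qed
  moreover have "openin (gtop G) ?T"
    using F(1) open_preimage_src by blast
  moreover have "x \<in> ?T" using F(3) x by simp
  ultimately show "\<exists>T. openin (gtop G) T \<and> x \<in> T \<and> T \<subseteq> units G"
    by (intro exI[of _ ?T]) blast
qed

lemma openin_unit_space: "openin (unit_space G) U \<longleftrightarrow> openin (gtop G) U \<and> U \<subseteq> units G"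
  using open_units by (rule openin_open_subtopology)

text \<open>Etaleness gives open maps into the unit space, and sets open there are open in
  \<open>G\<close> because the units form an open set.\<close>

lemma open_src_image: "openin (gtop G) U \<Longrightarrow> openin (gtop G) (src G ` U)"
  and open_rng_image: "openin (gtop G) U \<Longrightarrow> openin (gtop G) (rng G ` U)"
proof -
  have "open_map (gtop G) (unit_space G) (src G)" "open_map (gtop G) (unit_space G) (rng G)"
    using ample local_homeomorphism_imp_open_map unfolding ample_def etale_def by blast+
  then show "openin (gtop G) U \<Longrightarrow> openin (gtop G) (src G ` U)"
    "openin (gtop G) U \<Longrightarrow> openin (gtop G) (rng G ` U)"
    unfolding open_map_def openin_unit_space by blast+
qed

text \<open>Source and range are continuous and open, so injectivity on an open set already makes
  them homeomorphisms onto their images.\<close>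

lemma bisectionI:
  assumes "openin (gtop G) F" "inj_on (src G) F" "inj_on (rng G) F"
  shows "bisection G F"
proof -
  have F: "F \<subseteq> gcarrier G" using assms(1) by (rule openin_subset)
  have *: "homeomorphic_map (subtopology (gtop G) F) (subtopology (gtop G) (f ` F)) f"
    if "continuous_map (gtop G) (gtop G) f" "inj_on f F"
      "\<And>U. openin (gtop G) U \<Longrightarrow> openin (gtop G) (f ` U)" for f
  proof (rule bijective_open_imp_homeomorphic_map)
    show "continuous_map (subtopology (gtop G) F) (subtopology (gtop G) (f ` F)) f"
      using that(1) by (auto simp: continuous_map_in_subtopology continuous_map_from_subtopology)
    show "open_map (subtopology (gtop G) F) (subtopology (gtop G) (f ` F)) f"
      unfolding open_map_def using that(3) assms(1) by (auto simp: openin_open_subtopology)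
    have "f ` F \<subseteq> gcarrier G" using that(3)[OF assms(1)] by (rule openin_subset)
    then show "f ` topspace (subtopology (gtop G) F) = topspace (subtopology (gtop G) (f ` F))"
      using F by (simp add: Int_absorb1)
    show "inj_on f (topspace (subtopology (gtop G) F))"
      using F that(2) by (simp add: Int_absorb1)
  qed
  show ?thesis
    unfolding bisection_def
    using F *[OF continuous_src assms(2) open_src_image] *[OF continuous_rng assms(3) open_rng_image]
    by blast
qed

text \<open>Points that cannot be separated have equal source and range, since the unit space is
  Hausdorff.\<close>

lemma principal_imp_Hausdorff:
  assumes "principal_groupoid G"
  shows "Hausdorff_space (gtop G)"
  unfolding Hausdorff_space_def
proof (intro allI impI)
  fix g h assume "g \<in> gcarrier G \<and> h \<in> gcarrier G \<and> g \<noteq> h"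
  then have gh: "g \<in> gcarrier G" "h \<in> gcarrier G" "g \<noteq> h" by blast+
  have sep: "\<exists>U V. openin (gtop G) U \<and> openin (gtop G) V \<and> x \<in> U \<and> y \<in> V \<and> disjnt U V"
    if xy: "x \<in> units G" "y \<in> units G" "x \<noteq> y" for x y
  proof -
    have "Hausdorff_space (unit_space G)"
      using ample unfolding ample_def topological_groupoid_def by blast
    moreover have "x \<in> topspace (unit_space G)" "y \<in> topspace (unit_space G)"
      using xy units_subset by auto
    ultimately show ?thesis
      using xy(3) openin_unit_space unfolding Hausdorff_space_def by metis
  qed
  have "isotropy_group G (rng G g) = {rng G g}"
    using assms rng_in_units[OF gh(1)] unfolding principal_groupoid_def by blast
  then consider "src G g \<noteq> src G h" | "rng G g \<noteq> rng G h"
    using trivial_isotropy_eq gh by blast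
  then show "\<exists>U V. openin (gtop G) U \<and> openin (gtop G) V \<and> g \<in> U \<and> h \<in> V \<and> disjnt U V"
  proof cases
    case 1
    then obtain U V where UV: "openin (gtop G) U" "openin (gtop G) V" "src G g \<in> U" "src G h \<in> V" "disjnt U V"
      using sep[OF src_in_units[OF gh(1)] src_in_units[OF gh(2)]] by blast
    let ?p = "\<lambda>U. {g \<in> gcarrier G. src G g \<in> U}"
    have "disjnt (?p U) (?p V)" using UV(5) unfolding disjnt_def by blast
    then show ?thesis
      using UV(3,4) gh(1,2) open_preimage_src[OF UV(1)] open_preimage_src[OF UV(2)]
      by (intro exI[of _ "?p U"] exI[of _ "?p V"] conjI) simp_all
  next
    case 2
    then obtain U V where UV: "openin (gtop G) U" "openin (gtop G) V" "rng G g \<in> U" "rng G h \<in> V" "disjnt U V"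
      using sep[OF rng_in_units[OF gh(1)] rng_in_units[OF gh(2)]] by blast
    let ?p = "\<lambda>U. {g \<in> gcarrier G. rng G g \<in> U}"
    have "disjnt (?p U) (?p V)" using UV(5) unfolding disjnt_def by blast
    then show ?thesis
      using UV(3,4) gh(1,2) open_preimage_rng[OF UV(1)] open_preimage_rng[OF UV(2)]
      by (intro exI[of _ "?p U"] exI[of _ "?p V"] conjI) simp_all
  qed
qed

end

locale Hausdorff_ample_groupoid = ample_groupoid +
  assumes Hausdorff: "Hausdorff_space (gtop G)"
begin

section \<open>Compact open bisections and their products\<close>

text \<open>Stands for "compact open bisection"; the indicator functions of these sets span the
  Steinberg algebra.\<close>

definition cob :: "'a set \<Rightarrow> bool" where
  "cob F \<longleftrightarrow> openin (gtop G) F \<and> compactin (gtop G) F \<and> bisection G F"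

lemma cobD:
  assumes "cob F"
  shows "openin (gtop G) F" "compactin (gtop G) F" "bisection G F"
    "F \<subseteq> gcarrier G" "inj_on (src G) F" "inj_on (rng G) F"
  using assms bisectionD unfolding cob_def by auto

lemma cobI:
  "openin (gtop G) F \<Longrightarrow> compactin (gtop G) F \<Longrightarrow> inj_on (src G) F \<Longrightarrow> inj_on (rng G) F \<Longrightarrow> cob F"
  unfolding cob_def using bisectionI by blast

lemma obtain_cob:
  assumes "openin (gtop G) U" "g \<in> U"
  obtains F where "cob F" "g \<in> F" "F \<subseteq> U"
  using basis_bisection[OF assms] unfolding cob_def by metis

lemma obtain_cob_carrier:
  assumes "g \<in> gcarrier G"
  obtains F where "cob F" "g \<in> F"
  using obtain_cob[OF openin_topspace assms] by metis

lemma inj_on_units: "V \<subseteq> units G \<Longrightarrow> inj_on (src G) V" "V \<subseteq> units G \<Longrightarrow> inj_on (rng G) V"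
  by (metis inj_onI src_unit subsetD, metis inj_onI rng_unit subsetD)

lemma cob_unitsI:
  "openin (gtop G) V \<Longrightarrow> compactin (gtop G) V \<Longrightarrow> V \<subseteq> units G \<Longrightarrow> cob V"
  by (intro cobI inj_on_units)

lemma cob_closed: "cob F \<Longrightarrow> closedin (gtop G) F"
  using compactin_imp_closedin[OF Hausdorff] cobD(2) by blast

lemma cob_Int_clopen:
  assumes "cob F" "openin (gtop G) K" "closedin (gtop G) K"
  shows "cob (F \<inter> K)"
proof (rule cobI)
  show "compactin (gtop G) (F \<inter> K)"
    using compact_Int_closedin cobD(2)[OF assms(1)] assms(3) by blast
qed (use cobD[OF assms(1)] assms(2) in \<open>auto intro: inj_on_subset\<close>)

definition bisection_prod :: "'a set \<Rightarrow> 'a set \<Rightarrow> 'a set" where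
  "bisection_prod A B = {gmult G a b | a b. a \<in> A \<and> b \<in> B \<and> src G a = rng G b}"

text \<open>The product is the image under multiplication of the composable pairs in
  \<open>A \<times> B\<close>. These form a closed subset of a compact set, since two continuous
  maps into a Hausdorff space agree on a closed set.\<close>

lemma compactin_bisection_prod:
  assumes "compactin (gtop G) A" "compactin (gtop G) B"
  shows "compactin (gtop G) (bisection_prod A B)"
proof -
  let ?P = "prod_topology (gtop G) (gtop G)"
  have AB: "A \<subseteq> gcarrier G" "B \<subseteq> gcarrier G"
    using assms compactin_subset_topspace by blast+
  have "closedin ?P {p \<in> topspace ?P. src G (fst p) = rng G (snd p)}"
    by (rule closedin_continuous_maps_eq[OF Hausdorff])
       (intro continuous_map_compose[OF continuous_map_fst continuous_src, unfolded o_def]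
         continuous_map_compose[OF continuous_map_snd continuous_rng, unfolded o_def])+
  then have "closedin ?P (composable G)"
    by (simp add: composable_eq)
  moreover have "compactin ?P (A \<times> B)"
    using assms by (simp add: compactin_Times)
  ultimately have "compactin ?P (composable G \<inter> A \<times> B)"
    by (rule closed_Int_compactin)
  then have "compactin (subtopology ?P (composable G)) (composable G \<inter> A \<times> B)"
    by (simp add: compactin_subtopology)
  from image_compactin[OF this continuous_mult]
  have "compactin (gtop G) ((\<lambda>p. gmult G (fst p) (snd p)) ` (composable G \<inter> A \<times> B))" .
  moreover have "(\<lambda>p. gmult G (fst p) (snd p)) ` (composable G \<inter> A \<times> B) = bisection_prod A B"
  proof -
    have "composable G \<inter> A \<times> B = {(a, b). a \<in> A \<and> b \<in> B \<and> src G a = rng G b}"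
      using AB by (auto simp: composable_eq)
    then show ?thesis
      by (auto simp: bisection_prod_def image_iff Bex_def; blast)
  qed
  ultimately show ?thesis by simp
qed

text \<open>Solving \<open>g = ab\<close> for \<open>b\<close> turns membership into a condition on
  the left factor alone, which matches both the convolution formula and the preimage used for
  openness.\<close>

lemma bisection_prod_iff:
  assumes "A \<subseteq> gcarrier G" "B \<subseteq> gcarrier G"
  shows "g \<in> bisection_prod A B \<longleftrightarrow>
    g \<in> gcarrier G \<and> (\<exists>a\<in>A. rng G a = rng G g \<and> gmult G (ginv G a) g \<in> B)"
proof
  assume "g \<in> bisection_prod A B"
  then obtain a b where ab: "g = gmult G a b" "a \<in> A" "b \<in> B" "src G a = rng G b"
    unfolding bisection_prod_def by blast
  moreover have "a \<in> gcarrier G" "b \<in> gcarrier G" using ab assms by blast+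
  ultimately show "g \<in> gcarrier G \<and> (\<exists>a\<in>A. rng G a = rng G g \<and> gmult G (ginv G a) g \<in> B)"
    by (intro conjI bexI[of _ a]) simp_all
next
  assume "g \<in> gcarrier G \<and> (\<exists>a\<in>A. rng G a = rng G g \<and> gmult G (ginv G a) g \<in> B)"
  then obtain a where a: "g \<in> gcarrier G" "a \<in> A" "rng G a = rng G g" "gmult G (ginv G a) g \<in> B"
    by blast
  moreover have "a \<in> gcarrier G" using a assms by blast
  ultimately show "g \<in> bisection_prod A B"
    unfolding bisection_prod_def
    by (intro CollectI exI[of _ a] exI[of _ "gmult G (ginv G a) g"]) simp
qed

text \<open>Openness: locally \<open>AB\<close> is the preimage of \<open>B\<close> under \<open>g \<mapsto> \<sigma>(r(g))\<inverse> g\<close>, where \<open>\<sigma>\<close> is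
  the continuous section of \<open>r\<close> with image \<open>A\<close>.\<close>

lemma openin_bisection_prod:
  assumes A: "openin (gtop G) A" "bisection G A" and B: "openin (gtop G) B"
  shows "openin (gtop G) (bisection_prod A B)"
proof -
  have sub: "A \<subseteq> gcarrier G" "B \<subseteq> gcarrier G"
    using A B openin_subset by blast+
  obtain \<sigma> where "homeomorphic_maps (subtopology (gtop G) A) (subtopology (gtop G) (rng G ` A)) (rng G) \<sigma>"
    using A(2) unfolding bisection_def homeomorphic_map_maps by blast
  then have \<sigma>: "continuous_map (subtopology (gtop G) (rng G ` A)) (subtopology (gtop G) A) \<sigma>"
    and \<sigma>_rng: "\<And>a. a \<in> A \<Longrightarrow> \<sigma> (rng G a) = a"
    using sub unfolding homeomorphic_maps_def by (auto simp: subset_iff)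
  let ?D = "{g \<in> gcarrier G. rng G g \<in> rng G ` A}"
  let ?X = "subtopology (gtop G) ?D"
  let ?\<psi> = "\<lambda>g. gmult G (ginv G (\<sigma> (rng G g))) g"
  have D: "openin (gtop G) ?D"
    using A(1) by (intro open_preimage_rng open_rng_image)
  have top: "topspace ?X = ?D" by auto
  have "continuous_map ?X (subtopology (gtop G) (rng G ` A)) (rng G)"
    using continuous_rng by (auto simp: continuous_map_in_subtopology continuous_map_from_subtopology)
  from continuous_map_compose[OF this \<sigma>]
  have "continuous_map ?X (gtop G) (\<lambda>g. \<sigma> (rng G g))"
    by (simp add: continuous_map_in_subtopology o_def)
  then have "continuous_map ?X (gtop G) (\<lambda>g. ginv G (\<sigma> (rng G g)))"
    using continuous_map_compose[OF _ continuous_inv] by (simp add: o_def)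
  moreover have "continuous_map ?X (gtop G) (\<lambda>g. g)"
    using continuous_map_from_subtopology[OF continuous_map_id] by (simp add: id_def)
  moreover have "src G (ginv G (\<sigma> (rng G g))) = rng G g" if g: "g \<in> topspace ?X" for g
  proof -
    obtain a where "a \<in> A" "rng G g = rng G a" using g unfolding top by blast
    then show ?thesis using \<sigma>_rng[of a] sub(1) src_inv[of a] by (simp add: subset_iff)
  qed
  ultimately have "continuous_map ?X (gtop G) ?\<psi>"
    by (rule continuous_mult')
  from openin_continuous_map_preimage[OF this B]
  have "openin (gtop G) {g \<in> ?D. ?\<psi> g \<in> B}"
    using D unfolding top by (simp add: openin_open_subtopology)
  moreover have "{g \<in> ?D. ?\<psi> g \<in> B} = bisection_prod A B"
  proof (rule set_eqI)
    fix g
    show "g \<in> {g \<in> ?D. ?\<psi> g \<in> B} \<longleftrightarrow> g \<in> bisection_prod A B"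
      unfolding bisection_prod_iff[OF sub] using \<sigma>_rng by (simp add: image_iff) metis
  qed
  ultimately show ?thesis by simp
qed

lemma bisection_prodE:
  assumes "g \<in> bisection_prod A B" "A \<subseteq> gcarrier G" "B \<subseteq> gcarrier G"
  obtains a b where "a \<in> A" "b \<in> B" "a \<in> gcarrier G" "b \<in> gcarrier G" "src G a = rng G b"
    "g = gmult G a b"
  using assms unfolding bisection_prod_def by blast

text \<open>If \<open>ab\<close> and \<open>a'b'\<close> have the same source, then so do
  \<open>b\<close> and \<open>b'\<close>, whence \<open>b = b'\<close>; now \<open>a\<close> and
  \<open>a'\<close> have the same source, whence \<open>a = a'\<close>. For equal ranges the
  argument starts with the left factors.\<close>

lemma cob_bisection_prod:
  assumes "cob A" "cob B"
  shows "cob (bisection_prod A B)"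
proof (rule cobI)
  note A = cobD[OF assms(1)] and B = cobD[OF assms(2)]
  show "openin (gtop G) (bisection_prod A B)"
    using A B by (intro openin_bisection_prod)
  show "compactin (gtop G) (bisection_prod A B)"
    using A B by (intro compactin_bisection_prod)
  have *: "g = h" if g: "g \<in> bisection_prod A B" and h: "h \<in> bisection_prod A B"
    and eq: "src G g = src G h \<or> rng G g = rng G h" for g h
  proof -
    obtain a b where ab: "a \<in> A" "b \<in> B" "a \<in> gcarrier G" "b \<in> gcarrier G" "src G a = rng G b"
      "g = gmult G a b"
      using bisection_prodE[OF g A(4) B(4)] by metis
    obtain a' b' where ab': "a' \<in> A" "b' \<in> B" "a' \<in> gcarrier G" "b' \<in> gcarrier G"
      "src G a' = rng G b'" "h = gmult G a' b'"
      using bisection_prodE[OF h A(4) B(4)] by metis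
    have "src G b = src G b' \<or> rng G a = rng G a'"
      using eq ab ab' by simp
    then have "a = a' \<and> b = b'"
      using inj_onD[OF A(5)] inj_onD[OF A(6)] inj_onD[OF B(5)] inj_onD[OF B(6)] ab(1,2,5) ab'(1,2,5)
      by metis
    then show ?thesis using ab ab' by simp
  qed
  show "inj_on (src G) (bisection_prod A B)" "inj_on (rng G) (bisection_prod A B)"
    using * by (auto intro!: inj_onI)
qed

text \<open>An element has at most one left factor in the bisection \<open>A\<close>, so no
  multiplicities arise and the product is again a 0-1 function.\<close>

lemma convolution_indicator:
  assumes "cob A" "cob B"
  shows "convolution G (indicator A) (indicator B) = (indicator (bisection_prod A B) :: 'a \<Rightarrow> 'k::field)"
proof
  fix g
  note A = cobD[OF assms(1)] and B = cobD[OF assms(2)]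
  note iff = bisection_prod_iff[OF A(4) B(4), of g]
  show "convolution G (indicator A) (indicator B) g = (indicator (bisection_prod A B) g :: 'k)"
  proof (cases "g \<in> gcarrier G \<and> rng G g \<in> rng G ` A")
    case True
    then obtain a where a: "a \<in> A" "rng G a = rng G g" "g \<in> gcarrier G" by auto
    then have "g \<in> bisection_prod A B \<longleftrightarrow> gmult G (ginv G a) g \<in> B"
      using iff inj_onD[OF A(6)] by metis
    then show ?thesis
      using convolution_indicator_left[OF A(4,6) a(1) a(3) a(2), of "indicator B :: 'a \<Rightarrow> 'k"]
      by (simp add: indicator_def)
  next
    case False
    then have "g \<notin> bisection_prod A B" using iff by (metis imageI)
    then show ?thesis
      using False convolution_eq_0 convolution_indicator_left_eq_0 by (metis indicator_simps(2))
  qed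
qed


section \<open>The Steinberg algebra and its restrictions\<close>

lemma steinberg_algebra_eq:
  "steinberg_algebra G = fun_scale.span {indicator F :: 'a \<Rightarrow> 'k::field | F. cob F}"
  unfolding steinberg_algebra_def cob_def ..

text \<open>Induction over the span in pointwise form: one scaled indicator is added at a
  time.\<close>

lemma steinberg_induct [consumes 1, case_names zero step]:
  fixes f :: "'a \<Rightarrow> 'k::field"
  assumes "f \<in> steinberg_algebra G"
    and "P 0"
    and "\<And>c F f. cob F \<Longrightarrow> P f \<Longrightarrow> P (\<lambda>g. c * indicator F g + f g)"
  shows "P f"
  using assms(1) unfolding steinberg_algebra_eq
proof (induction rule: fun_scale.span_induct_alt)
  case base
  show ?case by (rule assms(2))
next
  case (step c F f)
  then show ?case using assms(3)[of _ f c] by (auto simp: fun_scale_def plus_fun_def)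
qed

lemma indicator_in_steinberg: "cob F \<Longrightarrow> indicator F \<in> (steinberg_algebra G :: ('a \<Rightarrow> 'k::field) set)"
  unfolding steinberg_algebra_eq by (auto intro: fun_scale.span_base)

lemma steinberg_linear:
  fixes f h :: "'a \<Rightarrow> 'k::field"
  assumes "f \<in> steinberg_algebra G" "h \<in> steinberg_algebra G"
  shows "(\<lambda>g. c * f g + h g) \<in> steinberg_algebra G"
proof -
  have "fun_scale c f + h \<in> steinberg_algebra G"
    using assms unfolding steinberg_algebra_eq by (intro fun_scale.span_add fun_scale.span_scale)
  then show ?thesis by (simp add: fun_scale_def plus_fun_def)
qed

lemma steinberg_zero: "0 \<in> (steinberg_algebra G :: ('a \<Rightarrow> 'k::field) set)"
  unfolding steinberg_algebra_eq by (rule fun_scale.span_zero)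

lemma steinberg_support:
  fixes f :: "'a \<Rightarrow> 'k::field"
  assumes "f \<in> steinberg_algebra G" "f g \<noteq> 0"
  shows "g \<in> gcarrier G"
  using assms
proof (induction rule: steinberg_induct)
  case (step c F f)
  then show ?case using cobD(4)[of F] by (cases "g \<in> F") auto
qed simp

text \<open>A bisection meets each fibre in at most one point. The finiteness lets convolutions with
  \<open>f\<close> be written as sums over a fixed finite set.\<close>

lemma steinberg_finite_fibres:
  fixes f :: "'a \<Rightarrow> 'k::field"
  assumes "f \<in> steinberg_algebra G"
  shows "finite {a \<in> gcarrier G. src G a = x \<and> f a \<noteq> 0} \<and>
    finite {a \<in> gcarrier G. rng G a = x \<and> f a \<noteq> 0}"
  using assms
proof (induction rule: steinberg_induct)
  case (step c F f)
  have "finite {a \<in> gcarrier G. p a = x \<and> c * indicator F a + f a \<noteq> 0}"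
    if "inj_on p F" "finite {a \<in> gcarrier G. p a = x \<and> f a \<noteq> 0}" for p
  proof (rule finite_subset)
    show "{a \<in> gcarrier G. p a = x \<and> c * indicator F a + f a \<noteq> 0} \<subseteq>
        {a \<in> F. p a = x} \<union> {a \<in> gcarrier G. p a = x \<and> f a \<noteq> 0}"
      by (auto simp: indicator_def)
    show "finite ({a \<in> F. p a = x} \<union> {a \<in> gcarrier G. p a = x \<and> f a \<noteq> 0})"
      using finite_fibre[OF that(1)] that(2) by simp
  qed
  then show ?case using step cobD(5,6)[OF step(1)] by simp
qed simp

section \<open>Bilinearity of convolution and closure under it\<close>

lemma convolution_zero [simp]:
  "convolution G 0 f = (0 :: 'a \<Rightarrow> 'k::field)" "convolution G f 0 = (0 :: 'a \<Rightarrow> 'k::field)"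
  by (simp_all add: convolution_def fun_eq_iff)

text \<open>The sum runs over the support of \<open>h\<close> in the source fibre of
  \<open>g\<close>. This finite set does not depend on the left factor, so the sum can be split term
  by term.\<close>

lemma convolution_linear_left:
  fixes f1 f2 h :: "'a \<Rightarrow> 'k::field"
  assumes "h \<in> steinberg_algebra G"
  shows "convolution G (\<lambda>g. c * f1 g + f2 g) h =
    (\<lambda>g. c * convolution G f1 h g + convolution G f2 h g)"
proof
  fix g
  show "convolution G (\<lambda>g. c * f1 g + f2 g) h g = c * convolution G f1 h g + convolution G f2 h g"
  proof (cases "g \<in> gcarrier G")
    case True
    let ?A = "{a \<in> gcarrier G. src G a = src G g \<and> h a \<noteq> 0}"
    have "convolution G f h g = (\<Sum>a\<in>?A. f (gmult G g (ginv G a)) * h a)" for f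
      using steinberg_finite_fibres[OF assms] by (intro convolution_right_sum True) auto
    then show ?thesis
      by (simp add: sum_distrib_left sum.distrib distrib_right mult.assoc)
  qed (simp add: convolution_eq_0)
qed

lemma convolution_linear_right:
  fixes f1 f2 h :: "'a \<Rightarrow> 'k::field"
  assumes "h \<in> steinberg_algebra G"
  shows "convolution G h (\<lambda>g. c * f1 g + f2 g) =
    (\<lambda>g. c * convolution G h f1 g + convolution G h f2 g)"
proof
  fix g
  show "convolution G h (\<lambda>g. c * f1 g + f2 g) g = c * convolution G h f1 g + convolution G h f2 g"
  proof (cases "g \<in> gcarrier G")
    case True
    let ?A = "{a \<in> gcarrier G. rng G a = rng G g \<and> h a \<noteq> 0}"
    have "convolution G h f g = (\<Sum>a\<in>?A. h a * f (gmult G (ginv G a) g))" for f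
      using steinberg_finite_fibres[OF assms] by (intro convolution_left_sum True) auto
    then show ?thesis
      by (simp add: sum_distrib_left sum.distrib distrib_left mult.left_commute)
  qed (simp add: convolution_eq_0)
qed

text \<open>Induction on \<open>f\<close> and then on \<open>h\<close> reduces the claim to two
  indicator functions, whose convolution is the indicator of a product of bisections.\<close>

lemma convolution_in_steinberg:
  fixes f h :: "'a \<Rightarrow> 'k::field"
  assumes f: "f \<in> steinberg_algebra G" and h: "h \<in> steinberg_algebra G"
  shows "convolution G f h \<in> steinberg_algebra G"
  using f
proof (induction rule: steinberg_induct)
  case zero
  show ?case unfolding convolution_zero by (rule steinberg_zero)
next
  case (step c A f)
  have "convolution G (indicator A) h \<in> steinberg_algebra G"
    using h
  proof (induction rule: steinberg_induct)
    case zero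
    show ?case unfolding convolution_zero by (rule steinberg_zero)
  next
    case (step c B h)
    then show ?case
      using \<open>cob A\<close>
      by (simp add: convolution_linear_right indicator_in_steinberg convolution_indicator
          steinberg_linear cob_bisection_prod)
  qed
  then show ?case using step by (simp add: convolution_linear_left h steinberg_linear)
qed

lemma convolution_supportE:
  fixes f h :: "'a \<Rightarrow> 'k::field"
  assumes "convolution G f h g \<noteq> 0"
  obtains a b where "a \<in> gcarrier G" "b \<in> gcarrier G" "src G a = rng G b" "g = gmult G a b"
    "f a \<noteq> 0" "h b \<noteq> 0"
proof -
  have "{(g1, g2) \<in> composable G. gmult G g1 g2 = g \<and> f g1 \<noteq> 0 \<and> h g2 \<noteq> 0} \<noteq> {}"
    using assms unfolding convolution_def by (metis (no_types, lifting) sum.empty)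
  then obtain a b where "(a, b) \<in> composable G" "gmult G a b = g" "f a \<noteq> 0" "h b \<noteq> 0"
    by blast
  with that composableD[of a b] show ?thesis by blast
qed

section \<open>Local constancy and supports\<close>

text \<open>In a Hausdorff groupoid compact open bisections are clopen, so their indicators are
  locally constant.\<close>

lemma steinberg_locally_constant:
  fixes f :: "'a \<Rightarrow> 'k::field"
  assumes "f \<in> steinberg_algebra G" "g \<in> gcarrier G"
  shows "\<exists>V. openin (gtop G) V \<and> g \<in> V \<and> (\<forall>x\<in>V. f x = f g)"
  using assms(1)
proof (induction rule: steinberg_induct)
  case zero
  show ?case using assms(2) by (intro exI[of _ "gcarrier G"]) simp
next
  case (step c F f)
  then obtain V where V: "openin (gtop G) V" "g \<in> V" "\<And>x. x \<in> V \<Longrightarrow> f x = f g" by blast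
  obtain W where W: "openin (gtop G) W" "g \<in> W" "\<And>x. x \<in> W \<Longrightarrow> x \<in> F \<longleftrightarrow> g \<in> F"
  proof (cases "g \<in> F")
    case True
    then show ?thesis using that[of F] cobD(1)[OF step(1)] by blast
  next
    case False
    then show ?thesis
      using that[of "gcarrier G - F"] cob_closed[OF step(1)] assms(2) by (simp add: closedin_def)
  qed
  have "c * indicator F x + f x = c * indicator F g + f g" if "x \<in> V \<inter> W" for x
    using V(3)[of x] W(3)[of x] that by (simp add: indicator_def)
  with V W show ?case by (intro exI[of _ "V \<inter> W"]) blast
qed

lemma
  fixes f :: "'a \<Rightarrow> 'k::field"
  assumes "f \<in> steinberg_algebra G"
  shows openin_steinberg_support: "openin (gtop G) {g. f g \<noteq> 0}"
    and closedin_steinberg_support: "closedin (gtop G) {g. f g \<noteq> 0}"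
proof -
  \<comment> \<open>Stated for an arbitrary predicate on values, so that it covers both the support
    and its complement.\<close>
  have *: "openin (gtop G) {g \<in> gcarrier G. P (f g)}" for P
  proof (subst openin_subopen, intro ballI)
    fix g assume g: "g \<in> {g \<in> gcarrier G. P (f g)}"
    then obtain V where V: "openin (gtop G) V" "g \<in> V" "\<forall>x\<in>V. f x = f g"
      using steinberg_locally_constant[OF assms] by blast
    have "V \<subseteq> {g \<in> gcarrier G. P (f g)}"
    proof
      fix x assume "x \<in> V"
      moreover from this have "f x = f g" using V(3) by (rule bspec[rotated])
      ultimately show "x \<in> {g \<in> gcarrier G. P (f g)}"
        using g openin_subset[OF V(1)] by auto
    qed
    with V show "\<exists>T. openin (gtop G) T \<and> g \<in> T \<and> T \<subseteq> {g \<in> gcarrier G. P (f g)}"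
      by blast
  qed
  have eq: "{g. f g \<noteq> 0} = {g \<in> gcarrier G. f g \<noteq> 0}"
    using steinberg_support[OF assms] by blast
  show "openin (gtop G) {g. f g \<noteq> 0}" unfolding eq by (rule *)
  have "gcarrier G - {g. f g \<noteq> 0} = {g \<in> gcarrier G. f g = 0}" by blast
  then show "closedin (gtop G) {g. f g \<noteq> 0}"
    using steinberg_support[OF assms] *[of "\<lambda>y. y = 0"] by (auto simp: closedin_def)
qed

section \<open>Restriction to an open set of units\<close>

text \<open>This is the underlying set of \<open>restrict_groupoid G U\<close>.\<close>

definition reduction :: "'a set \<Rightarrow> 'a set" where
  "reduction U = {g \<in> gcarrier G. src G g \<in> U \<and> rng G g \<in> U}"

lemma openin_reduction:
  assumes "openin (unit_space G) U"
  shows "openin (gtop G) (reduction U)"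
proof -
  have "reduction U = {g \<in> gcarrier G. src G g \<in> U} \<inter> {g \<in> gcarrier G. rng G g \<in> U}"
    unfolding reduction_def by blast
  moreover have "openin (gtop G) U"
    using assms unfolding openin_unit_space by blast
  ultimately show ?thesis
    by (simp only: openin_Int open_preimage_src open_preimage_rng)
qed

text \<open>The reduction is open in \<open>G\<close> and contains the sources and ranges of its
  elements. Hence its subsets are open, compact or bisections in the restriction exactly when they
  are so in \<open>G\<close>.\<close>

lemma steinberg_restrict_eq:
  assumes "openin (unit_space G) U"
  shows "steinberg_algebra (restrict_groupoid G U) =
    fun_scale.span {indicator F :: 'a \<Rightarrow> 'k::field | F. cob F \<and> F \<subseteq> reduction U}"
proof -
  let ?H = "reduction U"
  have top: "gtop (restrict_groupoid G U) = subtopology (gtop G) ?H"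
    unfolding restrict_groupoid_def reduction_def by (simp add: Let_def)
  have s: "src (restrict_groupoid G U) = src G" and r: "rng (restrict_groupoid G U) = rng G"
    unfolding restrict_groupoid_def src_def rng_def by (simp_all add: Let_def fun_eq_iff)
  have H: "openin (gtop G) ?H" using assms by (rule openin_reduction)
  then have HC: "?H \<subseteq> gcarrier G" by (rule openin_subset)
  have img: "src G ` F \<subseteq> ?H" "rng G ` F \<subseteq> ?H" if "F \<subseteq> ?H" for F
    using that unfolding reduction_def by (auto simp: subset_iff)
  have "openin (gtop (restrict_groupoid G U)) F \<and> compactin (gtop (restrict_groupoid G U)) F \<and>
      bisection (restrict_groupoid G U) F \<longleftrightarrow> cob F \<and> F \<subseteq> ?H" for F
  proof (cases "F \<subseteq> ?H")
    case True
    then have "bisection (restrict_groupoid G U) F \<longleftrightarrow> bisection G F"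
      using img[OF True] HC subset_trans[OF True HC]
      by (simp add: bisection_def top s r subtopology_subtopology Int_absorb1 Int_absorb2)
    then show ?thesis
      using True H unfolding cob_def top
      by (simp add: openin_open_subtopology compactin_subtopology)
  next
    case False
    then show ?thesis
      using H unfolding top by (auto simp: openin_open_subtopology)
  qed
  then show ?thesis unfolding steinberg_algebra_def by simp
qed

text \<open>Since the support \<open>K\<close> of \<open>f\<close> is clopen, each indicator \<open>1\<^sub>F\<close> in a representation of \<open>f\<close> may be
  replaced by \<open>1\<^sub>F\<^sub>\<inter>\<^sub>K\<close>.\<close>

lemma mem_steinberg_restrict_iff:
  fixes f :: "'a \<Rightarrow> 'k::field"
  assumes "openin (unit_space G) U"
  shows "f \<in> steinberg_algebra (restrict_groupoid G U) \<longleftrightarrow>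
    f \<in> steinberg_algebra G \<and> (\<forall>g. f g \<noteq> 0 \<longrightarrow> g \<in> reduction U)"
proof (intro iffI conjI allI)
  assume f: "f \<in> steinberg_algebra (restrict_groupoid G U)"
  show "f \<in> steinberg_algebra G"
    using f unfolding steinberg_restrict_eq[OF assms] steinberg_algebra_eq
    by (rule subsetD[OF fun_scale.span_mono, rotated]) blast
  fix g
  from f show "f g \<noteq> 0 \<longrightarrow> g \<in> reduction U"
    unfolding steinberg_restrict_eq[OF assms]
  proof (induction rule: fun_scale.span_induct_alt)
    case (step c F f)
    then show ?case by (auto simp: fun_scale_def indicator_def split: if_splits)
  qed simp
next
  assume f: "f \<in> steinberg_algebra G \<and> (\<forall>g. f g \<noteq> 0 \<longrightarrow> g \<in> reduction U)"
  define K where "K = {g. f g \<noteq> 0}"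
  have K: "openin (gtop G) K" "closedin (gtop G) K" "K \<subseteq> reduction U"
    using f openin_steinberg_support closedin_steinberg_support unfolding K_def by auto
  let ?S = "{indicator F :: 'a \<Rightarrow> 'k | F. cob F \<and> F \<subseteq> reduction U}"
  have "f \<in> steinberg_algebra G" using f by blast
  then have "(\<lambda>g. f g * indicator K g) \<in> fun_scale.span ?S"
  proof (induction rule: steinberg_induct)
    case zero
    show ?case using fun_scale.span_zero[of ?S] by (simp add: zero_fun_def)
  next
    case (step c F f)
    have "indicator (F \<inter> K) \<in> fun_scale.span ?S"
      using cob_Int_clopen[OF step(1) K(1,2)] K(3) by (intro fun_scale.span_base) blast
    then have "fun_scale c (indicator (F \<inter> K)) + (\<lambda>g. f g * indicator K g) \<in> fun_scale.span ?S"
      using step(2) by (intro fun_scale.span_add fun_scale.span_scale)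
    moreover have "fun_scale c (indicator (F \<inter> K)) + (\<lambda>g. f g * indicator K g) =
        (\<lambda>g. (c * indicator F g + f g) * indicator K g)"
      by (auto simp: fun_scale_def indicator_def fun_eq_iff)
    ultimately show ?case by simp
  qed
  moreover have "(\<lambda>g. f g * indicator K g) = f"
    by (auto simp: K_def indicator_def fun_eq_iff)
  ultimately show "f \<in> steinberg_algebra (restrict_groupoid G U)"
    unfolding steinberg_restrict_eq[OF assms] by simp
qed

text \<open>A product of two elements shares its range with the left factor and its source with the
  right one. If either factor lies over \<open>U\<close>, one end of the product is in
  \<open>U\<close>, and by invariance so is the other.\<close>

lemma steinberg_ideal_restrict:
  assumes U: "openin (unit_space G) U" and inv: "invariant G U"
  shows "steinberg_ideal G (steinberg_algebra (restrict_groupoid G U) :: ('a \<Rightarrow> 'k::field) set)"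
proof -
  note iff = mem_steinberg_restrict_iff[OF U]
  let ?J = "steinberg_algebra (restrict_groupoid G U) :: ('a \<Rightarrow> 'k) set"
  \<comment> \<open>The converse implication is invariance applied to the inverse of
    \<open>g\<close>.\<close>
  have inv': "src G g \<in> U \<longleftrightarrow> rng G g \<in> U" if "g \<in> gcarrier G" for g
    using that inv inv_closed[OF that] src_inv[OF that] rng_inv[OF that] unfolding invariant_def
    by metis
  have conv: "convolution G f h \<in> ?J \<and> convolution G h f \<in> ?J"
    if f: "f \<in> steinberg_algebra G" and h: "h \<in> ?J" for f h
  proof -
    have hG: "h \<in> steinberg_algebra G" and hU: "\<And>g. h g \<noteq> 0 \<Longrightarrow> g \<in> reduction U"
      using h iff by blast+
    have "g \<in> reduction U" if "convolution G f h g \<noteq> 0" for g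
      using that
    proof (rule convolution_supportE)
      fix a b assume "a \<in> gcarrier G" "b \<in> gcarrier G" "src G a = rng G b" "g = gmult G a b" "h b \<noteq> 0"
      then show ?thesis using hU[of b] inv'[of g] by (simp add: reduction_def)
    qed
    moreover have "g \<in> reduction U" if "convolution G h f g \<noteq> 0" for g
      using that
    proof (rule convolution_supportE)
      fix a b assume "a \<in> gcarrier G" "b \<in> gcarrier G" "src G a = rng G b" "g = gmult G a b" "h a \<noteq> 0"
      then show ?thesis using hU[of a] inv'[of g] by (simp add: reduction_def)
    qed
    ultimately show ?thesis
      using convolution_in_steinberg[OF f hG] convolution_in_steinberg[OF hG f] iff by blast
  qed
  have "0 \<in> ?J" "\<And>f h. f \<in> ?J \<Longrightarrow> h \<in> ?J \<Longrightarrow> f + h \<in> ?J"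
    unfolding steinberg_restrict_eq[OF U] by (auto intro: fun_scale.span_zero fun_scale.span_add)
  moreover have "- f \<in> ?J" if "f \<in> ?J" for f
    using that unfolding steinberg_restrict_eq[OF U] by (rule fun_scale.span_neg)
  moreover have "?J \<subseteq> steinberg_algebra G"
    using iff by blast
  ultimately show ?thesis
    unfolding steinberg_ideal_def using conv by (intro conjI ballI) blast+
qed


section \<open>Ideals\<close>

text \<open>Three cases. If no element of \<open>F\<close> starts at \<open>y\<close>, remove the
  closed set of sources of \<open>F\<close>. If the element of \<open>F\<close> starting at
  \<open>y\<close> also ends there, trivial isotropy identifies it with \<open>y\<close>, and near
  \<open>y\<close> the set \<open>F\<close> consists of units. If it ends elsewhere, the elements of
  \<open>F\<close> starting near \<open>y\<close> leave a small neighbourhood of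
  \<open>y\<close>.\<close>

lemma cob_near_trivial_isotropy:
  assumes "cob F" and y: "y \<in> units G" "isotropy_group G y = {y}"
  obtains W where "openin (gtop G) W" "y \<in> W" "W \<subseteq> units G"
    "\<And>g. g \<in> gcarrier G \<Longrightarrow> src G g \<in> W \<Longrightarrow> rng G g \<in> W \<Longrightarrow> g \<in> F \<longleftrightarrow> g \<in> units G \<and> y \<in> F"
proof (cases "y \<in> src G ` F")
  case False
  note F = cobD[OF assms(1)]
  have "closedin (gtop G) (src G ` F)"
    using compactin_imp_closedin[OF Hausdorff image_compactin[OF F(2) continuous_src]] .
  then have "openin (gtop G) (units G - src G ` F)"
    using open_units by (rule openin_diff[rotated])
  moreover have "y \<notin> F" using False src_unit[OF y(1)] by (metis imageI)
  ultimately show thesis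
    using that[of "units G - src G ` F"] y(1) False by blast
next
  case True
  then obtain a where a: "a \<in> F" "src G a = y" by blast
  note F = cobD[OF assms(1)]
  have aC: "a \<in> gcarrier G" using a F by blast
  show thesis
  proof (cases "rng G a = y")
    case True
    then have "a \<in> isotropy_group G y" using a(2) aC unfolding isotropy_group_def by simp
    then have "a = y" using y(2) by simp
    then have yF: "y \<in> F" using a(1) by simp
    have "g \<in> F \<longleftrightarrow> g \<in> units G \<and> y \<in> F" if g: "g \<in> gcarrier G" "src G g \<in> F \<inter> units G" for g
    proof
      assume "g \<in> F"
      then have "src G g = g"
        using inj_onD[OF F(5), of "src G g" g] g by simp
      then show "g \<in> units G \<and> y \<in> F" using g(2) yF by simp
    next
      assume "g \<in> units G \<and> y \<in> F"
      then show "g \<in> F" using g(2) src_unit[of g] by simp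
    qed
    moreover have "openin (gtop G) (F \<inter> units G)" using F(1) open_units by (rule openin_Int)
    ultimately show thesis using that[of "F \<inter> units G"] yF y(1) by blast
  next
    case False
    obtain A B where AB: "openin (gtop G) A" "openin (gtop G) B" "y \<in> A" "rng G a \<in> B" "disjnt A B"
      using Hausdorff False aC unit_closed[OF y(1)] rng_closed[OF aC]
      unfolding Hausdorff_space_def by metis
    let ?E = "F \<inter> {g \<in> gcarrier G. rng G g \<in> B}"
    \<comment> \<open>Since the source map is injective on \<open>F\<close>, every element of
      \<open>F\<close> starting in this set ends in \<open>B\<close>, hence outside
      \<open>A\<close>.\<close>
    let ?W = "A \<inter> src G ` ?E"
    have "openin (gtop G) ?W"
      using AB F(1) by (intro openin_Int open_src_image open_preimage_rng)
    moreover have "y \<in> ?W" using AB a aC by blast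
    moreover have "?W \<subseteq> units G" by auto
    moreover have "y \<notin> F"
    proof
      assume "y \<in> F"
      then have "y = a" using inj_onD[OF F(5), of y a] a y(1) by simp
      then show False using False y(1) by simp
    qed
    moreover have "g \<notin> F" if g: "src G g \<in> ?W" "rng G g \<in> ?W" for g
    proof
      assume "g \<in> F"
      obtain b where b: "b \<in> F" "rng G b \<in> B" "src G g = src G b" using g(1) by blast
      then have "g = b" using inj_onD[OF F(5)] \<open>g \<in> F\<close> by blast
      then show False using b(2) g(2) AB(5) unfolding disjnt_def by blast
    qed
    ultimately show thesis using that[of ?W] by blast
  qed
qed

text \<open>Over a small \<open>V\<close> the function is \<open>f(y)\<close> times the indicator of
  \<open>V\<close>, so compressing \<open>f\<close> by \<open>V\<close> recovers that indicator up
  to a scalar. Each induction step intersects two neighbourhoods.\<close>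

lemma steinberg_near_trivial_isotropy:
  fixes f :: "'a \<Rightarrow> 'k::field"
  assumes "f \<in> steinberg_algebra G" and y: "y \<in> units G" "isotropy_group G y = {y}"
  shows "\<exists>V. openin (gtop G) V \<and> y \<in> V \<and> V \<subseteq> units G \<and>
    (\<forall>g\<in>gcarrier G. src G g \<in> V \<longrightarrow> rng G g \<in> V \<longrightarrow> f g = (if g \<in> units G then f y else 0))"
  using assms(1)
proof (induction rule: steinberg_induct)
  case zero
  show ?case using open_units y(1) by (intro exI[of _ "units G"]) simp
next
  case (step c F f)
  then obtain V where V: "openin (gtop G) V" "y \<in> V" "V \<subseteq> units G"
    "\<And>g. g \<in> gcarrier G \<Longrightarrow> src G g \<in> V \<Longrightarrow> rng G g \<in> V \<Longrightarrow> f g = (if g \<in> units G then f y else 0)"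
    by blast
  obtain W where W: "openin (gtop G) W" "y \<in> W" "W \<subseteq> units G"
    "\<And>g. g \<in> gcarrier G \<Longrightarrow> src G g \<in> W \<Longrightarrow> rng G g \<in> W \<Longrightarrow> g \<in> F \<longleftrightarrow> g \<in> units G \<and> y \<in> F"
    using cob_near_trivial_isotropy[OF step(1) y] by metis
  have "c * indicator F g + f g = (if g \<in> units G then c * indicator F y + f y else 0)"
    if "g \<in> gcarrier G" "src G g \<in> V \<inter> W" "rng G g \<in> V \<inter> W" for g
    using V(4)[of g] W(4)[of g] that by (simp add: indicator_def)
  moreover have "openin (gtop G) (V \<inter> W)" using V W by blast
  ultimately show ?case using V W by (intro exI[of _ "V \<inter> W"]) blast
qed

section \<open>The two open invariant sets attached to an ideal\<close>

text \<open>The bisection \<open>P\<close> may contain non-units. This suits the proof of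
  invariance, where conjugation produces bisections that need not lie in the unit space.\<close>

definition lower_set :: "('a \<Rightarrow> 'k::field) set \<Rightarrow> 'a set" where
  "lower_set I = {x \<in> units G. \<exists>P. cob P \<and> x \<in> P \<and> (indicator P :: 'a \<Rightarrow> 'k) \<in> I}"

definition upper_set :: "('a \<Rightarrow> 'k::field) set \<Rightarrow> 'a set" where
  "upper_set I = {src G g | g f. f \<in> I \<and> f g \<noteq> 0}"

lemma openin_lower_set: "openin (unit_space G) (lower_set I)"
proof -
  have "lower_set I = units G \<inter> \<Union>{P. cob P \<and> indicator P \<in> I}"
    unfolding lower_set_def by blast
  moreover have "openin (gtop G) (units G \<inter> \<Union>{P. cob P \<and> indicator P \<in> I})"
    using open_units cobD(1) by (intro openin_Int openin_Union) blast+
  ultimately show ?thesis unfolding openin_unit_space by auto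
qed

context
  fixes I :: "('a \<Rightarrow> 'k::field) set"
  assumes I: "steinberg_ideal G I"
begin

lemma ideal_subset: "f \<in> I \<Longrightarrow> f \<in> steinberg_algebra G"
  and ideal_zero: "0 \<in> I"
  and ideal_add: "f \<in> I \<Longrightarrow> h \<in> I \<Longrightarrow> f + h \<in> I"
  and ideal_minus: "f \<in> I \<Longrightarrow> - f \<in> I"
  and ideal_left: "f \<in> steinberg_algebra G \<Longrightarrow> h \<in> I \<Longrightarrow> convolution G f h \<in> I"
  and ideal_right: "f \<in> steinberg_algebra G \<Longrightarrow> h \<in> I \<Longrightarrow> convolution G h f \<in> I"
  using I unfolding steinberg_ideal_def by blast+

text \<open>The definition of an ideal mentions only ring operations; scalars are brought into an
  ideal by convolving with scaled indicators.\<close>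

lemma steinberg_scaled_indicator: "cob F \<Longrightarrow> (\<lambda>g. c * indicator F g) \<in> (steinberg_algebra G :: ('a \<Rightarrow> 'k) set)"
  using steinberg_linear[OF indicator_in_steinberg steinberg_zero, of F c] by simp

lemma convolution_scaled_indicator:
  assumes "h \<in> (steinberg_algebra G :: ('a \<Rightarrow> 'k) set)"
  shows "convolution G (\<lambda>g. c * indicator F g) h = (\<lambda>g. c * convolution G (indicator F) h g)"
  using convolution_linear_left[OF assms, of c "indicator F" 0] unfolding convolution_zero by simp

text \<open>For a compact open \<open>V\<close> inside the units of \<open>P\<close>, the elements
  of \<open>P\<close> with source in \<open>V\<close> are those of \<open>V\<close> itself, by
  injectivity of the source map on \<open>P\<close>. So convolving the indicator of \<open>P\<close>
  with that of \<open>V\<close> gives the indicator of \<open>V\<close>.\<close>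

lemma obtain_unit_cob:
  assumes "x \<in> lower_set I"
  obtains V where "cob V" "V \<subseteq> units G" "x \<in> V" "indicator V \<in> I"
proof -
  obtain P where P: "cob P" "x \<in> P" "indicator P \<in> I" and x: "x \<in> units G"
    using assms unfolding lower_set_def by blast
  have "openin (gtop G) (P \<inter> units G)" using cobD(1)[OF P(1)] open_units by (rule openin_Int)
  then obtain V where V: "cob V" "x \<in> V" "V \<subseteq> P \<inter> units G"
    using obtain_cob[of "P \<inter> units G" x] P x by blast
  have "convolution G (indicator P) (indicator V) g = (indicator V g :: 'k)" for g
  proof (cases "g \<in> gcarrier G")
    case True
    have "g \<in> P \<and> src G g \<in> V \<longleftrightarrow> g \<in> V"
    proof
      assume g: "g \<in> P \<and> src G g \<in> V"
      then have "src G g = g"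
        using inj_onD[OF cobD(5)[OF P(1)], of "src G g" g] V(3) True by auto
      then show "g \<in> V" using g by simp
    next
      assume "g \<in> V"
      then show "g \<in> P \<and> src G g \<in> V" using V(3) src_unit[of g] by auto
    qed
    then show ?thesis
      using convolution_unit_right[of V g "indicator P :: 'a \<Rightarrow> 'k"] V(3) True
      by (auto simp: indicator_def)
  next
    case False
    then have "g \<notin> V" using cobD(4)[OF V(1)] by blast
    then show ?thesis using False by (simp add: convolution_eq_0)
  qed
  then have "convolution G (indicator P) (indicator V) = (indicator V :: 'a \<Rightarrow> 'k)" by blast
  then have "indicator V \<in> I"
    using ideal_right[OF indicator_in_steinberg[OF V(1)] P(3)] by simp
  then show thesis using that V by blast
qed

text \<open>Conjugation: with bisections \<open>A\<close> through \<open>g\<close> and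
  \<open>B\<close> through \<open>g^-1\<close>, the product \<open>A P B\<close> contains
  \<open>g s(g) g^-1 = r(g)\<close>, and its indicator stays in the ideal.\<close>

lemma invariant_lower_set: "invariant G (lower_set I)"
  unfolding invariant_def
proof (intro ballI impI)
  fix g assume g: "g \<in> gcarrier G" "src G g \<in> lower_set I"
  obtain P where P: "cob P" "src G g \<in> P" "indicator P \<in> I"
    using g(2) unfolding lower_set_def by blast
  obtain A where A: "cob A" "g \<in> A" using obtain_cob_carrier[OF g(1)] by metis
  obtain B where B: "cob B" "ginv G g \<in> B" using obtain_cob_carrier[OF inv_closed[OF g(1)]] by metis
  let ?AP = "bisection_prod A P"
  have cobs: "cob ?AP" "cob (bisection_prod ?AP B)"
    using A(1) P(1) B(1) by (auto intro: cob_bisection_prod)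
  have "gmult G g (src G g) \<in> ?AP"
    unfolding bisection_prod_def using A(2) P(2) rng_src[OF g(1)] by fastforce
  then have "g \<in> ?AP" using mult_src[OF g(1)] by simp
  then have "gmult G g (ginv G g) \<in> bisection_prod ?AP B"
    unfolding bisection_prod_def[of ?AP] using B(2) rng_inv[OF g(1)] by fastforce
  then have "rng G g \<in> bisection_prod ?AP B" by (simp add: rng_def)
  moreover have "indicator ?AP \<in> I"
    using ideal_left[OF indicator_in_steinberg[OF A(1)] P(3)] convolution_indicator[OF A(1) P(1)]
    by metis
  then have "indicator (bisection_prod ?AP B) \<in> I"
    using ideal_right[OF indicator_in_steinberg[OF B(1)]] convolution_indicator[OF cobs(1) B(1)]
    by metis
  ultimately show "rng G g \<in> lower_set I"
    unfolding lower_set_def using cobs(2) rng_in_units[OF g(1)] by blast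
qed

text \<open>Inclusion-exclusion: on sets of units, convolution of indicators is the indicator of the
  intersection, so the indicator of a union is the sum minus the convolution.\<close>

lemma finite_Union_unit_cob:
  assumes "finite \<F>" "\<F> \<subseteq> {V. cob V \<and> V \<subseteq> units G \<and> (indicator V :: 'a \<Rightarrow> 'k) \<in> I}"
  shows "cob (\<Union>\<F>) \<and> \<Union>\<F> \<subseteq> units G \<and> (indicator (\<Union>\<F>) :: 'a \<Rightarrow> 'k) \<in> I"
  using assms
proof (induction rule: finite_induct)
  case empty
  have "(indicator {} :: 'a \<Rightarrow> 'k) = 0" by (simp add: fun_eq_iff)
  then have "(indicator {} :: 'a \<Rightarrow> 'k) \<in> I" using ideal_zero by metis
  moreover have "cob {}" by (intro cob_unitsI) simp_all
  ultimately show ?case unfolding Union_empty by blast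
next
  case (insert V \<F>)
  let ?W = "\<Union>\<F>"
  have V: "cob V" "V \<subseteq> units G" "(indicator V :: 'a \<Rightarrow> 'k) \<in> I"
    and \<F>: "\<F> \<subseteq> {V. cob V \<and> V \<subseteq> units G \<and> (indicator V :: 'a \<Rightarrow> 'k) \<in> I}"
    using insert.prems by simp_all
  have W: "cob ?W" "?W \<subseteq> units G" "(indicator ?W :: 'a \<Rightarrow> 'k) \<in> I"
    using insert.IH[OF \<F>] by simp_all
  have sub: "V \<union> ?W \<subseteq> units G" using V(2) W(2) by blast
  have cob: "cob (V \<union> ?W)"
    using sub openin_Un[OF cobD(1)[OF V(1)] cobD(1)[OF W(1)]]
      compactin_Un[OF cobD(2)[OF V(1)] cobD(2)[OF W(1)]] by (intro cob_unitsI)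
  have "(indicator (V \<union> ?W) :: 'a \<Rightarrow> 'k) g =
      (indicator V + indicator ?W + - convolution G (indicator V) (indicator ?W)) g" for g
  proof (cases "g \<in> gcarrier G")
    case True
    have "g \<in> ?W \<Longrightarrow> rng G g \<in> V \<longleftrightarrow> g \<in> V" using subsetD[OF W(2)] rng_unit[of g] by simp
    then show ?thesis
      using convolution_unit_left[OF V(2) True, of "indicator ?W :: 'a \<Rightarrow> 'k"]
      by (cases "g \<in> ?W") (simp_all add: indicator_def del: Union_iff)
  next
    case False
    then have "g \<notin> V" "g \<notin> ?W" using cobD(4)[OF V(1)] cobD(4)[OF W(1)] by blast+
    then show ?thesis using False by (simp add: convolution_eq_0 indicator_def)
  qed
  then have "(indicator (V \<union> ?W) :: 'a \<Rightarrow> 'k) =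
      indicator V + indicator ?W + - convolution G (indicator V) (indicator ?W)" by blast
  moreover have "indicator V + indicator ?W + - convolution G (indicator V) (indicator ?W) \<in> I"
    by (intro ideal_add ideal_minus ideal_left indicator_in_steinberg V W)
  ultimately have "(indicator (V \<union> ?W) :: 'a \<Rightarrow> 'k) \<in> I" by metis
  then show ?case using cob sub unfolding Union_insert by blast
qed

text \<open>For a generator \<open>F\<close>, compactness covers its sources by finitely many sets
  of units whose indicators lie in \<open>I\<close>. The indicator of their union also lies in
  \<open>I\<close> and fixes the indicator of \<open>F\<close> from the right.\<close>

lemma steinberg_lower_set_subset: "steinberg_algebra (restrict_groupoid G (lower_set I)) \<subseteq> I"
proof
  fix f :: "'a \<Rightarrow> 'k"
  assume "f \<in> steinberg_algebra (restrict_groupoid G (lower_set I))"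
  then show "f \<in> I"
    unfolding steinberg_restrict_eq[OF openin_lower_set]
  proof (induction rule: fun_scale.span_induct_alt)
    case base
    show ?case by (rule ideal_zero)
  next
    case (step c u f)
    then obtain F where F: "cob F" "F \<subseteq> reduction (lower_set I)" and u: "u = indicator F" by blast
    let ?U = "{V. cob V \<and> V \<subseteq> units G \<and> (indicator V :: 'a \<Rightarrow> 'k) \<in> I}"
    have "compactin (gtop G) (src G ` F)"
      using image_compactin[OF cobD(2)[OF F(1)] continuous_src] .
    moreover have "openin (gtop G) V" if "V \<in> ?U" for V
      using that cobD(1) by blast
    moreover have "src G ` F \<subseteq> \<Union>?U"
    proof
      fix x assume "x \<in> src G ` F"
      then have "x \<in> lower_set I" using F(2) unfolding reduction_def by blast
      then show "x \<in> \<Union>?U" by (rule obtain_unit_cob) blast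
    qed
    ultimately obtain \<F> where \<F>: "finite \<F>" "\<F> \<subseteq> ?U" "src G ` F \<subseteq> \<Union>\<F>"
      using compactinD[of "gtop G" "src G ` F" ?U] by blast
    let ?V = "\<Union>\<F>"
    have V: "cob ?V" "?V \<subseteq> units G" "(indicator ?V :: 'a \<Rightarrow> 'k) \<in> I"
      using finite_Union_unit_cob[OF \<F>(1,2)] by blast+
    have "convolution G (indicator F) (indicator ?V) g = (indicator F g :: 'k)" for g
    proof (cases "g \<in> gcarrier G")
      case True
      have "g \<in> F \<Longrightarrow> src G g \<in> ?V" using \<F>(3) by blast
      then show ?thesis
        using convolution_unit_right[OF V(2) True, of "indicator F :: 'a \<Rightarrow> 'k"]
        by (auto simp: indicator_def)
    next
      case False
      then have "g \<notin> F" using cobD(4)[OF F(1)] by blast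
      then show ?thesis using False by (simp add: convolution_eq_0)
    qed
    then have "convolution G (\<lambda>g. c * indicator F g) (indicator ?V) = fun_scale c u"
      unfolding convolution_scaled_indicator[OF indicator_in_steinberg[OF V(1)]] u
      by (simp add: fun_scale_def)
    then have "fun_scale c u \<in> I"
      using ideal_left[OF steinberg_scaled_indicator[OF F(1)] V(3)] by metis
    then show ?case using step(2) by (rule ideal_add)
  qed
qed

text \<open>The heart of the argument: translate the nonzero value to the unit \<open>y\<close>,
  compress to a neighbourhood where only units contribute, and divide by the value at
  \<open>y\<close>.\<close>

lemma nonzero_in_lower_set:
  assumes f: "f \<in> I" "f g \<noteq> 0" and iso: "isotropy_group G (src G g) = {src G g}"
  shows "src G g \<in> lower_set I"
proof -
  define y where "y = src G g"
  have g: "g \<in> gcarrier G" using steinberg_support[OF ideal_subset[OF f(1)] f(2)] .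
  have y: "y \<in> units G" "isotropy_group G y = {y}"
    using g iso unfolding y_def by simp_all
  \<comment> \<open>Translating by a bisection through \<open>g^-1\<close> gives
    \<open>h(y) = f(g y) = f(g)\<close>.\<close>
  obtain F where F: "cob F" "ginv G g \<in> F"
    using obtain_cob_carrier[OF inv_closed[OF g]] by metis
  define h where "h = convolution G (indicator F) f"
  have h: "h \<in> I" unfolding h_def by (intro ideal_left indicator_in_steinberg F f)
  have "h y = f (gmult G (ginv G (ginv G g)) y)"
    unfolding h_def using g y(1) F(2) cobD[OF F(1)]
    by (intro convolution_indicator_left) (simp_all add: y_def)
  then have hy: "h y \<noteq> 0" using f(2) g by (simp add: y_def)
  obtain W where W: "openin (gtop G) W" "y \<in> W" "W \<subseteq> units G"
    "\<And>g. g \<in> gcarrier G \<Longrightarrow> src G g \<in> W \<Longrightarrow> rng G g \<in> W \<Longrightarrow> h g = (if g \<in> units G then h y else 0)"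
    using steinberg_near_trivial_isotropy[OF ideal_subset[OF h] y] by blast
  obtain V where V: "cob V" "y \<in> V" "V \<subseteq> W" using obtain_cob[OF W(1,2)] by metis
  have VU: "V \<subseteq> units G" using V W by blast
  let ?c = "inverse (h y)"
  \<comment> \<open>The right factor cuts \<open>h\<close> off to sources in \<open>V\<close>, the
    left one cuts it off to ranges in \<open>V\<close> and normalizes the value.\<close>
  let ?h' = "convolution G (\<lambda>g. ?c * indicator V g) (convolution G h (indicator V))"
  have hV: "convolution G h (indicator V) \<in> I"
    by (intro ideal_right indicator_in_steinberg V h)
  have "?h' x = indicator V x" for x
  proof (cases "x \<in> gcarrier G")
    case True
    have "?h' x = ?c * (indicator V (rng G x) * (h x * indicator V (src G x)))"
      unfolding convolution_scaled_indicator[OF ideal_subset[OF hV]]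
        convolution_unit_left[OF VU True] convolution_unit_right[OF VU True] ..
    also have "\<dots> = indicator V x"
    proof (cases "src G x \<in> V \<and> rng G x \<in> V")
      case True
      then have "h x = (if x \<in> units G then h y else 0)"
        using W(4)[OF \<open>x \<in> gcarrier G\<close>] V(3) by blast
      moreover have "x \<in> V \<longleftrightarrow> x \<in> units G" using True VU src_unit[of x] by auto
      ultimately show ?thesis using True hy by (simp add: indicator_def)
    next
      case False
      moreover have "x \<notin> V" using False VU src_unit[of x] rng_unit[of x] by auto
      ultimately show ?thesis by (auto simp: indicator_def)
    qed
    finally show ?thesis .
  next
    case False
    then have "x \<notin> V" using cobD(4)[OF V(1)] by blast
    then show ?thesis using False by (simp add: convolution_eq_0)
  qed
  then have "?h' = indicator V" by blast
  moreover have "?h' \<in> I" by (intro ideal_left steinberg_scaled_indicator V hV)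
  ultimately have "indicator V \<in> I" by simp
  then show ?thesis
    using V y unfolding lower_set_def y_def by blast
qed

text \<open>Supports of elements of \<open>I\<close> are open and the source map is open.\<close>

lemma openin_upper_set: "openin (unit_space G) (upper_set I)"
proof -
  have "upper_set I = (\<Union>f\<in>I. src G ` {g. f g \<noteq> 0})"
    unfolding upper_set_def by blast
  moreover have "openin (gtop G) (\<Union>f\<in>I. src G ` {g. f g \<noteq> 0})"
    using open_src_image openin_steinberg_support ideal_subset by (intro openin_Union) blast
  moreover have "src G g \<in> units G" if "f \<in> I" "f g \<noteq> 0" for f g
    using steinberg_support[OF ideal_subset[OF that(1)] that(2)] by simp
  ultimately show ?thesis unfolding openin_unit_space by auto
qed

text \<open>Right translation by a bisection through \<open>a^-1\<close> carries the value of
  \<open>f\<close> at \<open>g\<close> to \<open>g a^-1\<close>, whose source is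
  \<open>r(a)\<close>.\<close>

lemma invariant_upper_set: "invariant G (upper_set I)"
  unfolding invariant_def
proof (intro ballI impI)
  fix a assume a: "a \<in> gcarrier G" "src G a \<in> upper_set I"
  then obtain f g where f: "f \<in> I" "f g \<noteq> 0" "src G a = src G g"
    unfolding upper_set_def by blast
  have g: "g \<in> gcarrier G" using steinberg_support[OF ideal_subset[OF f(1)] f(2)] .
  obtain F where F: "cob F" "ginv G a \<in> F"
    using obtain_cob_carrier[OF inv_closed[OF a(1)]] by metis
  let ?g = "gmult G g (ginv G a)"
  have "convolution G f (indicator F) ?g = f g"
  proof -
    have gC: "?g \<in> gcarrier G" and gs: "src G ?g = src G (ginv G a)" using a g f by simp_all
    have "{b \<in> gcarrier G. src G b = src G ?g \<and> indicator F b \<noteq> (0::'k)} \<subseteq> {ginv G a}"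
      using gs F(2) by (auto simp: indicator_def intro: inj_onD[OF cobD(5)[OF F(1)]])
    then have "convolution G f (indicator F) ?g =
        (\<Sum>b\<in>{ginv G a}. f (gmult G ?g (ginv G b)) * indicator F b)"
      using gC gs a by (intro convolution_right_sum) simp_all
    then show ?thesis using F(2) a g f(3) by simp
  qed
  then have "convolution G f (indicator F) ?g \<noteq> 0" using f(2) by simp
  moreover have "convolution G f (indicator F) \<in> I"
    by (intro ideal_right indicator_in_steinberg F f)
  moreover have "src G ?g = rng G a" using a g f by simp
  ultimately show "rng G a \<in> upper_set I"
    unfolding upper_set_def by (metis (mono_tags, lifting) mem_Collect_eq)
qed

lemma subset_steinberg_upper_set: "I \<subseteq> steinberg_algebra (restrict_groupoid G (upper_set I))"
proof
  fix f assume f: "f \<in> I"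
  have "g \<in> reduction (upper_set I)" if "f g \<noteq> 0" for g
  proof -
    have g: "g \<in> gcarrier G" using steinberg_support[OF ideal_subset[OF f] that] .
    moreover have "src G g \<in> upper_set I" unfolding upper_set_def using f that by blast
    moreover from this have "rng G g \<in> upper_set I"
      using g invariant_upper_set unfolding invariant_def by blast
    ultimately show ?thesis unfolding reduction_def by blast
  qed
  then show "f \<in> steinberg_algebra (restrict_groupoid G (upper_set I))"
    unfolding mem_steinberg_restrict_iff[OF openin_upper_set] using ideal_subset[OF f] by blast
qed

lemma lower_set_subset_upper_set: "lower_set I \<subseteq> upper_set I"
proof
  fix x assume "x \<in> lower_set I"
  then obtain P where "x \<in> units G" "x \<in> P" "indicator P \<in> I"
    unfolding lower_set_def by blast
  moreover from this have "src G x = x" "(indicator P :: 'a \<Rightarrow> 'k) x \<noteq> 0" by simp_all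
  ultimately show "x \<in> upper_set I"
    unfolding upper_set_def by (metis (mono_tags, lifting) mem_Collect_eq)
qed

lemma lower_set_dense:
  assumes "essentially_principal G"
  shows "subtopology (unit_space G) (upper_set I) closure_of lower_set I = upper_set I"
proof
  have U: "openin (gtop G) (upper_set I)" "upper_set I \<subseteq> units G"
    using openin_upper_set unfolding openin_unit_space by blast+
  show "subtopology (unit_space G) (upper_set I) closure_of lower_set I \<subseteq> upper_set I"
    using closure_of_subset_topspace by fastforce
  show "upper_set I \<subseteq> subtopology (unit_space G) (upper_set I) closure_of lower_set I"
  proof
    fix x assume x: "x \<in> upper_set I"
    have "\<exists>y. y \<in> lower_set I \<and> y \<in> T"
      if T: "x \<in> T" "openin (subtopology (unit_space G) (upper_set I)) T" for T
    proof -
      have TU: "openin (gtop G) T"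
        using T(2) openin_upper_set openin_open_subtopology openin_unit_space by blast
      obtain f g where f: "f \<in> I" "f g \<noteq> 0" "x = src G g"
        using x unfolding upper_set_def by blast
      \<comment> \<open>The sources of the part of the support of \<open>f\<close> lying over
        \<open>T\<close> form an open set of units containing \<open>x\<close>. Any unit with
        trivial isotropy in it lies in \<open>lower_set I\<close> and in \<open>T\<close>.\<close>
      let ?E = "{g. f g \<noteq> 0} \<inter> {g \<in> gcarrier G. src G g \<in> T}"
      have "g \<in> ?E"
        using f T(1) steinberg_support[OF ideal_subset[OF f(1)] f(2)] by blast
      then have xE: "x \<in> src G ` ?E" using f(3) by blast
      have "openin (gtop G) (src G ` ?E)"
        by (intro open_src_image openin_Int open_preimage_src TU openin_steinberg_support
            ideal_subset f)
      moreover have "src G ` ?E \<subseteq> units G" by auto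
      ultimately have E: "openin (unit_space G) (src G ` ?E)"
        unfolding openin_unit_space by blast
      have "x \<in> unit_space G closure_of {x \<in> units G. isotropy_group G x = {x}}"
        using assms x U(2) unfolding essentially_principal_def by blast
      then obtain y where y: "isotropy_group G y = {y}" "y \<in> src G ` ?E"
        using xE E unfolding in_closure_of by (metis (mono_tags, lifting) mem_Collect_eq)
      then obtain g' where g': "y = src G g'" "f g' \<noteq> 0" "y \<in> T" by blast
      then have "y \<in> lower_set I"
        using nonzero_in_lower_set[OF f(1) g'(2)] y(1) by simp
      then show ?thesis using g'(3) by blast
    qed
    moreover have "x \<in> topspace (subtopology (unit_space G) (upper_set I))"
      using x U(2) units_subset by auto
    ultimately show "x \<in> subtopology (unit_space G) (upper_set I) closure_of lower_set I"
      unfolding in_closure_of by blast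
  qed
qed

lemma lower_set_eq_upper_set:
  assumes "principal_groupoid G"
  shows "lower_set I = upper_set I"
proof
  show "upper_set I \<subseteq> lower_set I"
  proof
    fix x assume "x \<in> upper_set I"
    then obtain f g where f: "f \<in> I" "f g \<noteq> 0" "x = src G g"
      unfolding upper_set_def by blast
    have "src G g \<in> units G" using steinberg_support[OF ideal_subset[OF f(1)] f(2)] by simp
    then have "isotropy_group G (src G g) = {src G g}"
      using assms unfolding principal_groupoid_def by blast
    then show "x \<in> lower_set I" using nonzero_in_lower_set[OF f(1,2)] f(3) by simp
  qed
qed (rule lower_set_subset_upper_set)

end

section \<open>The bijection with open invariant sets\<close>

text \<open>The open set can be recovered from its algebra: the indicator of a compact open
  neighbourhood of \<open>x\<close> inside \<open>U\<close> belongs to the first algebra, and its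
  value at \<open>x\<close> puts \<open>x\<close> into \<open>U'\<close>.\<close>

lemma subset_if_steinberg_restrict_subset:
  assumes U: "openin (unit_space G) U" and U': "openin (unit_space G) U'"
    and sub: "(steinberg_algebra (restrict_groupoid G U) :: ('a \<Rightarrow> 'k::field) set) \<subseteq>
      steinberg_algebra (restrict_groupoid G U')"
  shows "U \<subseteq> U'"
proof
  fix x assume x: "x \<in> U"
  have UG: "openin (gtop G) U" "U \<subseteq> units G" using U unfolding openin_unit_space by blast+
  obtain V where V: "cob V" "x \<in> V" "V \<subseteq> U" using obtain_cob[OF UG(1) x] by metis
  have "V \<subseteq> reduction U"
  proof
    fix v assume "v \<in> V"
    then have "v \<in> U" "v \<in> units G" using V(3) UG(2) by blast+
    then show "v \<in> reduction U" unfolding reduction_def by simp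
  qed
  then have "(indicator V :: 'a \<Rightarrow> 'k) \<in> steinberg_algebra (restrict_groupoid G U)"
    unfolding mem_steinberg_restrict_iff[OF U] using indicator_in_steinberg[OF V(1)]
    by (auto simp: indicator_def split: if_splits)
  then have "(indicator V :: 'a \<Rightarrow> 'k) \<in> steinberg_algebra (restrict_groupoid G U')"
    using sub by blast
  moreover have "(indicator V :: 'a \<Rightarrow> 'k) x \<noteq> 0" using V(2) by simp
  ultimately have "x \<in> reduction U'"
    unfolding mem_steinberg_restrict_iff[OF U'] by blast
  moreover have "src G x = x" using x UG(2) src_unit by blast
  ultimately show "x \<in> U'" unfolding reduction_def by simp
qed

text \<open>For surjectivity, the lower and upper sets of \<open>I\<close> coincide, so the two
  inclusions squeeze \<open>I\<close> to the algebra of that set.\<close>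

lemma bij_betw_steinberg_ideals:
  assumes "principal_groupoid G"
  shows "bij_betw (\<lambda>U. steinberg_algebra (restrict_groupoid G U) :: ('a \<Rightarrow> 'k::field) set)
    {U. openin (unit_space G) U \<and> invariant G U} {I. steinberg_ideal G I}"
  unfolding bij_betw_def
proof
  show "inj_on (\<lambda>U. steinberg_algebra (restrict_groupoid G U) :: ('a \<Rightarrow> 'k) set)
      {U. openin (unit_space G) U \<and> invariant G U}"
  proof (rule inj_onI)
    fix U U'
    assume "U \<in> {U. openin (unit_space G) U \<and> invariant G U}"
      "U' \<in> {U. openin (unit_space G) U \<and> invariant G U}"
      "(steinberg_algebra (restrict_groupoid G U) :: ('a \<Rightarrow> 'k) set) =
        steinberg_algebra (restrict_groupoid G U')"
    then show "U = U'"
      using subset_if_steinberg_restrict_subset[of U U', where 'k = 'k]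
        subset_if_steinberg_restrict_subset[of U' U, where 'k = 'k] by blast
  qed
  show "(\<lambda>U. steinberg_algebra (restrict_groupoid G U) :: ('a \<Rightarrow> 'k) set) `
      {U. openin (unit_space G) U \<and> invariant G U} = {I. steinberg_ideal G I}"
  proof (intro equalityI subsetI)
    fix I :: "('a \<Rightarrow> 'k) set" assume "I \<in> {I. steinberg_ideal G I}"
    then have I: "steinberg_ideal G I" by simp
    have "I = steinberg_algebra (restrict_groupoid G (upper_set I))"
      using steinberg_lower_set_subset[OF I] subset_steinberg_upper_set[OF I]
      unfolding lower_set_eq_upper_set[OF I assms] by blast
    then show "I \<in> (\<lambda>U. steinberg_algebra (restrict_groupoid G U) :: ('a \<Rightarrow> 'k) set) `
        {U. openin (unit_space G) U \<and> invariant G U}"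
      using openin_upper_set[OF I] invariant_upper_set[OF I] by blast
  qed (use steinberg_ideal_restrict in blast)
qed

end

theorem theorem3p7:
  fixes G :: "'a groupoid"
  assumes "ample G"
  shows
    "(Hausdorff_space (gtop G) \<and> essentially_principal G \<longrightarrow>
       (\<forall>I :: ('a \<Rightarrow> 'k::field) set. steinberg_ideal G I \<longrightarrow>
         (\<exists>U1 U2. openin (unit_space G) U1 \<and> invariant G U1 \<and>
            openin (unit_space G) U2 \<and> invariant G U2 \<and>
            U1 \<subseteq> U2 \<and> subtopology (unit_space G) U2 closure_of U1 = U2 \<and>
            steinberg_algebra (restrict_groupoid G U1) \<subseteq> I \<and>
            I \<subseteq> steinberg_algebra (restrict_groupoid G U2)))) \<and>
     (principal_groupoid G \<longrightarrow>
       bij_betw (\<lambda>U. steinberg_algebra (restrict_groupoid G U) :: ('a \<Rightarrow> 'k) set)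
         {U. openin (unit_space G) U \<and> invariant G U}
         {I. steinberg_ideal G I})"
proof (intro conjI impI allI)
  fix I :: "('a \<Rightarrow> 'k) set"
  assume H: "Hausdorff_space (gtop G) \<and> essentially_principal G" and I: "steinberg_ideal G I"
  interpret Hausdorff_ample_groupoid G
    using assms H by unfold_locales blast+
  show "\<exists>U1 U2. openin (unit_space G) U1 \<and> invariant G U1 \<and>
      openin (unit_space G) U2 \<and> invariant G U2 \<and>
      U1 \<subseteq> U2 \<and> subtopology (unit_space G) U2 closure_of U1 = U2 \<and>
      steinberg_algebra (restrict_groupoid G U1) \<subseteq> I \<and>
      I \<subseteq> steinberg_algebra (restrict_groupoid G U2)"
    using openin_lower_set invariant_lower_set[OF I] openin_upper_set[OF I] invariant_upper_set[OF I]
      lower_set_subset_upper_set[OF I] lower_set_dense[OF I] H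
      steinberg_lower_set_subset[OF I] subset_steinberg_upper_set[OF I]
    by (intro exI[of _ "lower_set I"] exI[of _ "upper_set I"]) simp
next
  assume P: "principal_groupoid G"
  interpret ample_groupoid G
    using assms by unfold_locales
  \<comment> \<open>In the second part the Hausdorff property is supplied by principality.\<close>
  interpret Hausdorff_ample_groupoid G
    using principal_imp_Hausdorff[OF P] by unfold_locales
  show "bij_betw (\<lambda>U. steinberg_algebra (restrict_groupoid G U) :: ('a \<Rightarrow> 'k) set)
      {U. openin (unit_space G) U \<and> invariant G U} {I. steinberg_ideal G I}"
    using P by (rule bij_betw_steinberg_ideals)
qed

end
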